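(* Let $\lambda,\mu\in\Lambda$. Then $R_\lambda(\rho+\mu;r)=0$ unless $\lambda\sqsubseteq\mu$.
   Context: Let $k$ be a field of characteristic zero, $n\ge 1$, $\mathcal P=k[z_1,\dots,z_n]$, and let $W\subseteq S_n$ be the group of permutations $\pi$ with $\pi(i)\equiv i \bmod 2$ for all $i$, acting by permuting variables. $\Lambda$ is the set of integer tuples $\lambda=(\lambda_1\ge\dots\ge\lambda_n\ge 0)$ and $|\lambda|_{\rm odd}=\sum_{i\text{ odd}}\lambda_i$. Fix $r\in k$ which is not a negative rational number and put $\rho=((n-1)r,(n-2)r,\dots,r,0)$. For $\lambda\in\Lambda$ let $[\lambda]\in\mathbb N^n$ be given by $[\lambda]_m=\lambda_m-\lambda_{m+1}+\dots+(-1)^{n-m}\lambda_n$; in particular $[\lambda]_1=\lambda_1-\lambda_2+\lambda_3-\cdots$. $R_\lambda(z)=R_\lambda(z;r)\in\mathcal P^W$ is the unique $W$-invariant polynomial of degree $|\lambda|_{\rm odd}$ which satisfies $R_\lambda(\rho+\mu)=0$ for all $\mu\in\Lambda$ with $|\mu|_{\rm odd}\le|\lambda|_{\rm odd}$, $\mu\ne\lambda$, and in which the monomial $z^{[\lambda]}$ has coefficient $1$ (it is known that this exists and is unique). For $\lambda,\mu\in\Lambda$, $\lambda\sqsubseteq\mu$ means: $\lambda_i\le\mu_i$ for all $i$, and $[\lambda]_1\le[\mu]_1$. *)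

theory Defs
  imports Complex_Main "HOL-Library.Poly_Mapping" "HOL-Combinatorics.Permutations"
    "HOL-Number_Theory.Cong"
begin

text \<open>
  A polynomial over \<open>'k\<close> in the variables \<open>z\<^sub>0, z\<^sub>1, \<dots>\<close> is a finitely supported map from
  exponent vectors to coefficients; the ring \<open>k[z\<^sub>1,\<dots>,z\<^sub>n]\<close> consists of those in which only
  \<open>z\<^sub>1, \<dots>, z\<^sub>n\<close> occur.
\<close>

type_synonym monomial = "nat \<Rightarrow>\<^sub>0 nat"
type_synonym 'k mpoly = "monomial \<Rightarrow>\<^sub>0 'k"

definition polys :: "nat \<Rightarrow> 'k::field_char_0 mpoly set" where
  "polys n = {p. \<forall>m \<in> Poly_Mapping.keys p. Poly_Mapping.keys m \<subseteq> {1..n}}"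

definition eval_poly :: "'k::field_char_0 mpoly \<Rightarrow> (nat \<Rightarrow> 'k) \<Rightarrow> 'k" where
  "eval_poly p x = (\<Sum>m \<in> Poly_Mapping.keys p. Poly_Mapping.lookup p m *
      (\<Prod>i \<in> Poly_Mapping.keys m. x i ^ Poly_Mapping.lookup m i))"

definition monomial_degree :: "monomial \<Rightarrow> nat" where
  "monomial_degree m = (\<Sum>i \<in> Poly_Mapping.keys m. Poly_Mapping.lookup m i)"

text \<open>The zero polynomial gets degree \<open>0\<close> here.\<close>

definition total_degree :: "'k::field_char_0 mpoly \<Rightarrow> nat" where
  "total_degree p = Max (insert 0 (monomial_degree ` Poly_Mapping.keys p))"

definition W :: "nat \<Rightarrow> (nat \<Rightarrow> nat) set" where
  "W n = {\<pi>. \<pi> permutes {1..n} \<and> (\<forall>i \<in> {1..n}. [\<pi> i = i] (mod 2))}"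

text \<open>
  The substitution \<open>z\<^sub>i \<mapsto> z\<^bsub>\<pi>(i)\<^esub>\<close>. For a bijection \<open>\<pi>\<close>, the exponent vector
  \<open>Poly_Mapping.map_key (inv \<pi>) m\<close> is \<open>m \<circ> inv \<pi>\<close>, that is, it has the entry \<open>m\<^sub>i\<close> at
  position \<open>\<pi>(i)\<close>.
\<close>

definition permute_vars :: "(nat \<Rightarrow> nat) \<Rightarrow> 'k::field_char_0 mpoly \<Rightarrow> 'k mpoly" where
  "permute_vars \<pi> p = (\<Sum>m \<in> Poly_Mapping.keys p.
      Poly_Mapping.single (Poly_Mapping.map_key (inv \<pi>) m) (Poly_Mapping.lookup p m))"

definition invariant_polys :: "nat \<Rightarrow> 'k::field_char_0 mpoly set" where
  "invariant_polys n = {p \<in> polys n. \<forall>\<pi> \<in> W n. permute_vars \<pi> p = p}"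

text \<open>
  A tuple \<open>(\<lambda>\<^sub>1, \<dots>, \<lambda>\<^sub>n)\<close> is a function on \<open>nat\<close> that is \<open>0\<close> outside \<open>{1..n}\<close>, so that
  equality of functions is equality of tuples.
\<close>

definition Lam :: "nat \<Rightarrow> (nat \<Rightarrow> nat) set" where
  "Lam n = {lam. (\<forall>i. i \<notin> {1..n} \<longrightarrow> lam i = 0) \<and>
      (\<forall>i \<in> {1..n}. \<forall>j \<in> {1..n}. i \<le> j \<longrightarrow> lam j \<le> lam i)}"

definition odd_size :: "nat \<Rightarrow> (nat \<Rightarrow> nat) \<Rightarrow> nat" where
  "odd_size n lam = (\<Sum>i \<in> {i \<in> {1..n}. odd i}. lam i)"

definition bracket :: "nat \<Rightarrow> (nat \<Rightarrow> nat) \<Rightarrow> nat \<Rightarrow> int" where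
  "bracket n lam m = (\<Sum>i = m..n. (-1) ^ (i - m) * int (lam i))"

lemma bracket_bounds:
  assumes "lam \<in> Lam n" "1 \<le> m" "m \<le> n"
  shows "0 \<le> bracket n lam m" "bracket n lam m \<le> int (lam m)"
proof -
  have "0 \<le> bracket n lam m \<and> bracket n lam m \<le> int (lam m)"
    using assms(3,2)
  proof (induction m rule: inc_induct)
    case base
    then show ?case by (simp add: bracket_def)
  next
    case (step m)
    have "bracket n lam m = int (lam m) + (\<Sum>i = Suc m..n. (-1) ^ (i - m) * int (lam i))"
      using step.hyps by (simp add: bracket_def sum.atLeast_Suc_atMost)
    also have "(\<Sum>i = Suc m..n. (-1) ^ (i - m) * int (lam i)) = - bracket n lam (Suc m)"
      unfolding bracket_def sum_negf[symmetric]
    proof (rule sum.cong)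
      fix i assume "i \<in> {Suc m..n}"
      then have "i - m = Suc (i - Suc m)" by auto
      then show "(-1) ^ (i - m) * int (lam i) = - ((-1) ^ (i - Suc m) * int (lam i))" by simp
    qed simp
    finally have "bracket n lam m = int (lam m) - bracket n lam (Suc m)" by simp
    moreover have "lam (Suc m) \<le> lam m"
      using assms(1) step.hyps step.prems by (simp add: Lam_def)
    ultimately show ?case using step.IH by simp
  qed
  then show "0 \<le> bracket n lam m" "bracket n lam m \<le> int (lam m)" by auto
qed

text \<open>
  The exponent vector of \<open>z\<^sup>[\<^sup>\<lambda>\<^sup>]\<close>; by \<open>bracket_bounds\<close> the conversion \<open>nat\<close> does not
  truncate when \<open>\<lambda> \<in> Lam n\<close>.
\<close>

definition bracket_monomial :: "nat \<Rightarrow> (nat \<Rightarrow> nat) \<Rightarrow> monomial" where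
  "bracket_monomial n lam = (\<Sum>m = 1..n. Poly_Mapping.single m (nat (bracket n lam m)))"

definition rho :: "nat \<Rightarrow> 'k::field_char_0 \<Rightarrow> nat \<Rightarrow> 'k" where
  "rho n r i = of_nat (n - i) * r"

definition shifted :: "nat \<Rightarrow> 'k::field_char_0 \<Rightarrow> (nat \<Rightarrow> nat) \<Rightarrow> nat \<Rightarrow> 'k" where
  "shifted n r mu i = rho n r i + of_nat (mu i)"

text \<open>
  \<open>is_R n r \<lambda> R\<close> says that \<open>R\<close> is the polynomial \<open>R\<^sub>\<lambda>(z; r)\<close>. If \<open>r\<close> is not a negative
  rational number, exactly one polynomial has this property for each \<open>\<lambda> \<in> Lam n\<close>.
\<close>

definition is_R :: "nat \<Rightarrow> 'k::field_char_0 \<Rightarrow> (nat \<Rightarrow> nat) \<Rightarrow> 'k mpoly \<Rightarrow> bool" where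
  "is_R n r lam R \<longleftrightarrow>
     R \<in> invariant_polys n \<and>
     total_degree R = odd_size n lam \<and>
     (\<forall>mu \<in> Lam n. odd_size n mu \<le> odd_size n lam \<longrightarrow> mu \<noteq> lam \<longrightarrow>
        eval_poly R (shifted n r mu) = 0) \<and>
     Poly_Mapping.lookup R (bracket_monomial n lam) = 1"

definition sqle :: "nat \<Rightarrow> (nat \<Rightarrow> nat) \<Rightarrow> (nat \<Rightarrow> nat) \<Rightarrow> bool" where
  "sqle n lam mu \<longleftrightarrow> (\<forall>i \<in> {1..n}. lam i \<le> mu i) \<and> bracket n lam 1 \<le> bracket n mu 1"

end

theory Submission
  imports Defs "HOL-Computational_Algebra.Polynomial"
begin

text \<open>
  Call a \<open>W n\<close>-invariant polynomial semisymmetric, write \<open>\<bar>\<mu>\<bar>\<close> for \<open>odd_size n \<mu>\<close>, and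
  identify \<open>\<mu>\<close> in \<open>Lam n\<close> with the point \<open>\<rho> + \<mu>\<close>. The proof exhibits a difference
  operator \<open>E\<close> that has every \<open>R\<^sub>\<lambda>\<close> as an eigenfunction and that moves \<open>\<mu>\<close> only downwards
  in the order \<open>\<sqsubseteq>\<close>. It has the form \<open>E f(z) = \<Sum>\<^sub>\<tau> c\<^sub>\<tau>(z) (f(z) - f(z - \<tau>))\<close>, where \<open>\<tau>\<close>
  runs through the unit vectors \<open>e\<^sub>i\<close> with \<open>i\<close> odd and through the sums \<open>e\<^sub>i + e\<^sub>j\<close> with \<open>i\<close>
  odd and \<open>j\<close> even. Passing from \<open>\<mu>\<close> to \<open>\<mu> - \<tau>\<close> lowers \<open>\<bar>\<mu>\<bar>\<close> by one and does not increase
  \<open>[\<mu>]\<^sub>1\<close>. With \<open>u(z) = z\<^sub>i\<close> for odd \<open>n\<close>, and \<open>u(z) = 1\<close> respectively \<open>u(z) = z\<^sub>j\<close> for even \<open>n\<close>,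
  the coefficients are

  \<open>c\<^sub>i = u \<Prod>\<^sub>j (z\<^sub>i - z\<^sub>j - r) / \<Prod>\<^sub>i\<^sub>' (z\<^sub>i - z\<^sub>i\<^sub>')\<close>,

  \<open>c\<^sub>i\<^sub>j = u \<Prod>\<^sub>j\<^sub>' (z\<^sub>i - z\<^sub>j\<^sub>' - r) \<Prod>\<^sub>i\<^sub>' (z\<^sub>j - z\<^sub>i\<^sub>' - r) / (\<Prod>\<^sub>i\<^sub>' (z\<^sub>i - z\<^sub>i\<^sub>') \<Prod>\<^sub>j\<^sub>' (z\<^sub>j - z\<^sub>j\<^sub>'))\<close>,

  where \<open>i'\<close> runs through the odd indices other than \<open>i\<close>, the index \<open>j\<close> of the product
  in \<open>c\<^sub>i\<close> through all even indices, and \<open>j'\<close> through the even indices other than \<open>j\<close>.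

  The following facts make the argument work.

  \<^item> \<open>E\<close> maps semisymmetric polynomials to semisymmetric polynomials and does not
  raise the degree (\<open>weighted_sum_polynomial\<close>): the double sum is an iterated
  divided difference, so its poles cancel, and the coefficients have degree \<open>1\<close>
  while \<open>f(z) - f(z - \<tau>)\<close> has smaller degree than \<open>f\<close>.

  \<^item> At \<open>\<rho> + \<mu>\<close> the coefficient of \<open>\<tau>\<close> vanishes unless \<open>\<mu> - \<tau>\<close> is again in \<open>Lam n\<close>
  (\<open>single_num_cutoff\<close>, \<open>pair_num_cutoff\<close>).

  \<^item> The coefficients at \<open>\<rho> + \<mu>\<close> add up to \<open>\<bar>\<mu>\<bar>\<close> (\<open>weighted_sum_one\<close>).

  \<^item> A semisymmetric polynomial of degree at most \<open>d\<close> that vanishes at \<open>\<rho> + \<mu>\<close>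
  whenever \<open>\<bar>\<mu>\<bar> \<le> d\<close> is zero (\<open>semisym_zero_if_zero_on_shifted\<close>).

  Hence \<open>E f(\<rho> + \<mu>) = \<bar>\<mu>\<bar> f(\<rho> + \<mu>)\<close> as soon as \<open>f\<close> vanishes at all points of \<open>Lam n\<close>
  that lie directly below \<open>\<mu>\<close>, that is, have the form \<open>\<mu> - \<tau>\<close>. With \<open>d = \<bar>\<lambda>\<bar>\<close>, this and
  the last fact give \<open>E R\<^sub>\<lambda> = d R\<^sub>\<lambda>\<close>. If \<open>\<lambda> \<sqsubseteq> \<mu>\<close> fails, then it also fails for every
  point directly below \<open>\<mu>\<close>, so induction on \<open>\<bar>\<mu>\<bar>\<close> yields \<open>(\<bar>\<mu>\<bar> - d) R\<^sub>\<lambda>(\<rho> + \<mu>) = 0\<close>; for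
  \<open>\<bar>\<mu>\<bar> > d\<close> the first factor is not zero, and for \<open>\<bar>\<mu>\<bar> \<le> d\<close> the vanishing is part of
  the definition of \<open>R\<^sub>\<lambda>\<close>.

  One difficulty remains: for \<open>r = 0\<close> the coordinates of \<open>\<rho> + \<mu>\<close> may coincide, and
  the coefficients cannot be evaluated there. Therefore \<open>r\<close> is treated as a further
  variable, with index \<open>0\<close>. The formula for \<open>E f(\<rho> + \<mu>)\<close> is established for all
  positive integers in place of \<open>r\<close>. As functions of this variable the coefficients
  are regular at the actual \<open>r\<close> (\<open>regular_single_coeff\<close>, \<open>regular_pair_coeff\<close>), so the
  formula extends to \<open>r\<close> (\<open>difference_operator\<close>).
\<close>

section \<open>Polynomial functions\<close>

text \<open>
  Polynomial functions in the variables \<open>x 0, x 1, \<dots>\<close>, of degree strictly less than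
  \<open>d\<close>. With a strict bound, \<open>deg_lt 0\<close> holds only for the zero function, and truncated
  subtraction of degrees is the right one when a polynomial is divided by linear
  factors. Functions may replace formal polynomials because a field of
  characteristic zero is infinite.
\<close>

inductive deg_lt :: "nat \<Rightarrow> ((nat \<Rightarrow> 'k::field_char_0) \<Rightarrow> 'k) \<Rightarrow> bool" where
  zero: "deg_lt d (\<lambda>_. 0)"
| const: "deg_lt (Suc d) (\<lambda>_. c)"
| var: "deg_lt d f \<Longrightarrow> deg_lt (Suc d) (\<lambda>x. x i * f x)"
| add: "deg_lt d f \<Longrightarrow> deg_lt d g \<Longrightarrow> deg_lt d (\<lambda>x. f x + g x)"

lemma deg_lt_0: "deg_lt 0 f \<Longrightarrow> f x = 0"
  by (induction "0::nat" f rule: deg_lt.induct) auto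

lemma deg_lt_mono: "deg_lt d f \<Longrightarrow> d \<le> e \<Longrightarrow> deg_lt e f"
proof (induction arbitrary: e rule: deg_lt.induct)
  case (zero d)
  show ?case by (rule deg_lt.zero)
next
  case (const d c)
  then obtain e' where "e = Suc e'" by (cases e) auto
  then show ?case by (simp add: deg_lt.const)
next
  case (var d f i)
  then obtain e' where "e = Suc e'" "d \<le> e'" by (cases e) auto
  then show ?case using var.IH by (simp add: deg_lt.var)
next
  case (add d f g)
  then show ?case by (simp add: deg_lt.add)
qed

lemma deg_lt_var: "deg_lt 2 (\<lambda>x. x i)"
proof -
  have "deg_lt (Suc (Suc 0)) (\<lambda>x. x i * 1)" by (intro deg_lt.intros)
  then show ?thesis by (simp add: numeral_2_eq_2)
qed

lemma deg_lt_scale: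
  assumes "deg_lt d f"
  shows "deg_lt d (\<lambda>x. c * f x)"
  using assms
proof induction
  case (zero d)
  then show ?case by (simp add: deg_lt.zero)
next
  case (const d c')
  show ?case by (rule deg_lt.const)
next
  case (var d f i)
  have "deg_lt (Suc d) (\<lambda>x. x i * (c * f x))" by (rule deg_lt.var) (rule var.IH)
  then show ?case by (simp add: mult.left_commute)
next
  case (add d f g)
  then show ?case by (simp add: deg_lt.add distrib_left)
qed

lemma deg_lt_mult:
  assumes "deg_lt d f" "deg_lt (Suc e) g"
  shows "deg_lt (d + e) (\<lambda>x. f x * g x)"
  using assms(1)
proof induction
  case (zero d)
  then show ?case by (simp add: deg_lt.zero)
next
  case (const d c)
  show ?case by (rule deg_lt_mono[OF deg_lt_scale[OF assms(2)]]) simp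
next
  case (var d f i)
  then have "deg_lt (Suc (d + e)) (\<lambda>x. x i * (f x * g x))" by (intro deg_lt.var)
  then show ?case by (simp add: mult.assoc)
next
  case (add d f h)
  then show ?case by (simp add: deg_lt.add distrib_right)
qed

lemma deg_lt_diff:
  assumes "deg_lt d f" "deg_lt d g"
  shows "deg_lt d (\<lambda>x. f x - g x)"
  using deg_lt.add[OF assms(1) deg_lt_scale[OF assms(2), of "-1"]] by simp

lemma deg_lt_sum:
  assumes "\<And>i. i \<in> S \<Longrightarrow> deg_lt d (f i)"
  shows "deg_lt d (\<lambda>x. \<Sum>i\<in>S. f i x)"
  using assms
proof (induction S rule: infinite_finite_induct)
  case (insert a S)
  then have "deg_lt d (\<lambda>x. f a x + (\<Sum>i\<in>S. f i x))" by (intro deg_lt.add) auto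
  then show ?case using insert.hyps by simp
qed (auto intro: deg_lt.zero)

lemma deg_lt_mult_linear:
  assumes "deg_lt d f" "deg_lt 2 l"
  shows "deg_lt (Suc d) (\<lambda>x. l x * f x)"
proof -
  have "deg_lt (d + Suc 0) (\<lambda>x. f x * l x)"
    using assms by (intro deg_lt_mult) (simp_all add: numeral_2_eq_2)
  then show ?thesis by (simp add: mult.commute)
qed

lemma deg_lt_prod_linear:
  assumes "finite S" "\<And>i. i \<in> S \<Longrightarrow> deg_lt 2 (l i)"
  shows "deg_lt (Suc (card S)) (\<lambda>x. \<Prod>i\<in>S. l i x)"
  using assms
proof (induction S rule: finite_induct)
  case empty
  then show ?case by (simp add: deg_lt.const)
next
  case (insert a S)
  then have "deg_lt (Suc (Suc (card S))) (\<lambda>x. l a x * (\<Prod>i\<in>S. l i x))"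
    by (intro deg_lt_mult_linear) auto
  then show ?case using insert.hyps by simp
qed

lemma deg_lt_const: "0 < d \<Longrightarrow> deg_lt d (\<lambda>_. c)"
  by (cases d) (auto intro: deg_lt.const)

lemmas deg_lt_linear = deg_lt_var deg_lt_const deg_lt_diff deg_lt.add

lemma deg_lt_subst:
  assumes "deg_lt d f" "\<And>i. deg_lt 2 (\<sigma> i)"
  shows "deg_lt d (\<lambda>x. f (\<lambda>i. \<sigma> i x))"
  using assms(1)
proof induction
  case (var d f i)
  then show ?case using deg_lt_mult_linear[OF var.IH assms(2)[of i]] by simp
qed (auto intro: deg_lt.intros)

lemma deg_lt_fun_upd:
  assumes "deg_lt d f" "deg_lt 2 c"
  shows "deg_lt d (\<lambda>x. f (x(a := c x)))"
proof -
  have "deg_lt d (\<lambda>x. f (\<lambda>i. (if i = a then c else (\<lambda>x. x i)) x))"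
    by (rule deg_lt_subst[OF assms(1)]) (simp add: assms(2) deg_lt_var)
  moreover have "(\<lambda>i. (if i = a then c else (\<lambda>x. x i)) x) = x(a := c x)" for x
    by auto
  ultimately show ?thesis by simp
qed

lemma deg_lt_on_curve:
  assumes "deg_lt d f" "\<And>i. \<exists>p. \<forall>t. \<sigma> i t = poly p t"
  shows "\<exists>p. \<forall>t. f (\<lambda>i. \<sigma> i t) = poly p t"
  using assms(1)
proof induction
  case (zero d)
  show ?case by (intro exI[of _ 0]) simp
next
  case (const d c)
  show ?case by (intro exI[of _ "[:c:]"]) simp
next
  case (var d f i)
  then obtain p q where "\<forall>t. f (\<lambda>i. \<sigma> i t) = poly p t" "\<forall>t. \<sigma> i t = poly q t"
    using assms(2) by blast
  then show ?case by (intro exI[of _ "q * p"]) simp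
next
  case (add d f g)
  then obtain p q where "\<forall>t. f (\<lambda>i. \<sigma> i t) = poly p t" "\<forall>t. g (\<lambda>i. \<sigma> i t) = poly q t"
    by blast
  then show ?case by (intro exI[of _ "p + q"]) simp
qed

text \<open>
  On the line through \<open>a\<close> and \<open>b\<close> both functions become univariate polynomials, whose
  product vanishes identically.
\<close>

lemma deg_lt_no_zero_divisors:
  assumes f: "deg_lt d f" and g: "deg_lt e g"
    and fg: "\<And>x. f x * g x = 0" and a: "f a \<noteq> 0"
  shows "g b = 0"
proof -
  define \<sigma> where "\<sigma> i t = a i + t * (b i - a i)" for i t
  have \<sigma>: "\<exists>p. \<forall>t. \<sigma> i t = poly p t" for i
    by (intro exI[of _ "[:a i, b i - a i:]"]) (simp add: \<sigma>_def)
  obtain p where p: "\<And>t. f (\<lambda>i. \<sigma> i t) = poly p t"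
    using deg_lt_on_curve[of d f \<sigma>, OF f \<sigma>] by blast
  obtain q where q: "\<And>t. g (\<lambda>i. \<sigma> i t) = poly q t"
    using deg_lt_on_curve[of e g \<sigma>, OF g \<sigma>] by blast
  have "poly (p * q) t = 0" for t
    using fg[of "\<lambda>i. \<sigma> i t"] by (simp only: poly_mult p q)
  then have "p * q = 0" using poly_all_0_iff_0 by blast
  moreover have "poly p 0 \<noteq> 0" using a by (simp add: p[symmetric] \<sigma>_def)
  ultimately have "q = 0" by auto
  then show ?thesis using q[of 1] by (simp add: \<sigma>_def)
qed

text \<open>
  Division with remainder by the linear form \<open>x a - c x\<close>, where the remainder is
  obtained by substituting \<open>c x\<close> for the variable \<open>x a\<close>. If \<open>f\<close> vanishes on the
  hyperplane, the quotient shows that it is divisible.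
\<close>

lemma deg_lt_division:
  assumes "deg_lt d f" "deg_lt 2 c"
  shows "\<exists>g. deg_lt (d - 1) g \<and> (\<forall>x. f x = f (x(a := c x)) + (x a - c x) * g x)"
  using assms(1)
proof induction
  case (zero d)
  show ?case by (intro exI[of _ "\<lambda>_. 0"]) (simp add: deg_lt.zero)
next
  case (const d k)
  show ?case by (intro exI[of _ "\<lambda>_. 0"]) (simp add: deg_lt.zero)
next
  case (var d f i)
  then obtain g where g: "deg_lt (d - 1) g"
    "\<And>x. f x = f (x(a := c x)) + (x a - c x) * g x" by blast
  have lift: "deg_lt d (\<lambda>x. l x * g x)" if "deg_lt 2 l" for l
  proof (cases d)
    case 0
    then show ?thesis using g(1) by (simp add: deg_lt_0 deg_lt.zero)
  next
    case (Suc d')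
    then show ?thesis using deg_lt_mult_linear[OF g(1) that] by simp
  qed
  show ?case
  proof (cases "i = a")
    case True
    have "deg_lt d (\<lambda>x. f x + c x * g x)"
      using var.hyps lift[OF assms(2)] by (rule deg_lt.add)
    moreover have "x i * f x = (x(a := c x)) i * f (x(a := c x))
        + (x a - c x) * (f x + c x * g x)" for x
      using True by (simp add: g(2)[of x] algebra_simps)
    ultimately show ?thesis
      unfolding diff_Suc_1 by (intro exI[of _ "\<lambda>x. f x + c x * g x"] conjI allI)
  next
    case False
    have "x i * f x = (x(a := c x)) i * f (x(a := c x)) + (x a - c x) * (x i * g x)" for x
      using False by (simp add: g(2)[of x] algebra_simps)
    with lift[OF deg_lt_var[of i]] show ?thesis
      unfolding diff_Suc_1 by (intro exI[of _ "\<lambda>x. x i * g x"] conjI allI)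
  qed
next
  case (add d f h)
  then obtain g g' where g: "deg_lt (d - 1) g" "deg_lt (d - 1) g'"
    and eq: "\<And>x. f x = f (x(a := c x)) + (x a - c x) * g x"
      "\<And>x. h x = h (x(a := c x)) + (x a - c x) * g' x" by blast
  have "f x + h x = f (x(a := c x)) + h (x(a := c x)) + (x a - c x) * (g x + g' x)" for x
    unfolding eq(1)[of x] eq(2)[of x] by (simp add: algebra_simps)
  with deg_lt.add[OF g] show ?case
    by (intro exI[of _ "\<lambda>x. g x + g' x"] conjI allI)
qed

lemma deg_lt_difference:
  assumes "deg_lt d f"
  shows "deg_lt (d - 1) (\<lambda>x. f x - f (\<lambda>i. x i - v i))"
  using assms
proof induction
  case (var d f i)
  have "deg_lt d (\<lambda>x. x i * (f x - f (\<lambda>j. x j - v j)))"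
  proof (cases d)
    case 0
    then show ?thesis using var.hyps by (simp add: deg_lt_0 deg_lt.zero)
  next
    case (Suc d')
    then show ?thesis using deg_lt.var[OF var.IH, of i] by simp
  qed
  moreover have "deg_lt d (\<lambda>x. v i * f (\<lambda>j. x j - v j))"
    by (intro deg_lt_scale deg_lt_subst[OF var.hyps] deg_lt_linear) auto
  ultimately have "deg_lt d (\<lambda>x. x i * (f x - f (\<lambda>j. x j - v j)) + v i * f (\<lambda>j. x j - v j))"
    by (rule deg_lt.add)
  then show ?case by (simp add: algebra_simps)
next
  case (add d f g)
  then have "deg_lt (d - 1) (\<lambda>x. (f x - f (\<lambda>i. x i - v i)) + (g x - g (\<lambda>i. x i - v i)))"
    by (intro deg_lt.add)
  then show ?case by (simp add: algebra_simps)
qed (auto intro: deg_lt.zero)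

text \<open>
  The Zariski density of the points with distinct coordinates: the product of all
  differences \<open>x i - x j\<close> is not the zero function, since it does not vanish at
  \<open>of_nat\<close>.
\<close>

lemma deg_lt_zero_if_zero_on_inj:
  assumes "deg_lt d f" "finite S" "\<And>x. inj_on x S \<Longrightarrow> f x = 0"
  shows "f y = 0"
proof -
  define D where "D = (\<lambda>x::nat \<Rightarrow> 'a. \<Prod>(i, j)\<in>{(i, j) \<in> S \<times> S. i \<noteq> j}. x i - x j)"
  have fin: "finite {(i, j) \<in> S \<times> S. i \<noteq> j}"
    using assms(2) by (auto intro: finite_subset[of _ "S \<times> S"])
  have "deg_lt (Suc (card {(i, j) \<in> S \<times> S. i \<noteq> j})) D"
    unfolding D_def using fin by (intro deg_lt_prod_linear) (auto intro!: deg_lt_linear)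
  moreover have "D of_nat \<noteq> 0"
    unfolding D_def using fin by auto
  moreover have "D x * f x = 0" for x
  proof (cases "inj_on x S")
    case True
    then show ?thesis using assms(3) by simp
  next
    case False
    then have "D x = 0" unfolding D_def using fin by (auto simp: inj_on_def)
    then show ?thesis by simp
  qed
  ultimately show ?thesis using deg_lt_no_zero_divisors assms(1) by blast
qed

section \<open>Divided differences\<close>

lemma partial_fractions:
  fixes x :: "'i \<Rightarrow> 'k::field"
  assumes "finite S" "inj_on x S" "t \<notin> x ` S" "S \<noteq> {}"
  shows "(\<Sum>i\<in>S. 1 / ((t - x i) * (\<Prod>j\<in>S - {i}. x i - x j))) = 1 / (\<Prod>i\<in>S. t - x i)"
  using assms(1,4,2,3)
proof (induction S arbitrary: t rule: finite_ne_induct)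
  case (singleton a)
  then show ?case by simp
next
  case (insert b S)
  let ?p = "\<lambda>i. \<Prod>j\<in>S - {i}. x i - x j"
  have b: "x b \<notin> x ` S" and tb: "t - x b \<noteq> 0" and inj: "inj_on x S" and t: "t \<notin> x ` S"
    using insert.prems insert.hyps by auto
  have split: "1 / ((t - x i) * (\<Prod>j\<in>insert b S - {i}. x i - x j))
      = (1 / (t - x b)) * (1 / ((t - x i) * ?p i)) - (1 / (t - x b)) * (1 / ((x b - x i) * ?p i))"
    if i: "i \<in> S" for i
  proof -
    have "insert b S - {i} = insert b (S - {i})" using i insert.hyps by auto
    then have *: "(\<Prod>j\<in>insert b S - {i}. x i - x j) = (x i - x b) * ?p i"
      using insert.hyps by simp
    have "x i \<noteq> x b" "x i \<noteq> t" using i b t by (metis image_eqI)+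
    then have "t - x i \<noteq> 0" "x i - x b \<noteq> 0" "x b - x i \<noteq> 0" by auto
    then have "1 / ((t - x i) * ((x i - x b) * P))
      = (1 / (t - x b)) * (1 / ((t - x i) * P)) - (1 / (t - x b)) * (1 / ((x b - x i) * P))"
      if "P \<noteq> 0" for P
      using tb that by (simp add: divide_simps) (simp add: algebra_simps)
    moreover have "?p i \<noteq> 0" using inj i insert.hyps by (auto simp: inj_on_def)
    ultimately show ?thesis unfolding * by blast
  qed
  have "(\<Sum>i\<in>insert b S. 1 / ((t - x i) * (\<Prod>j\<in>insert b S - {i}. x i - x j)))
      = 1 / ((t - x b) * (\<Prod>j\<in>S. x b - x j))
        + (\<Sum>i\<in>S. 1 / ((t - x i) * (\<Prod>j\<in>insert b S - {i}. x i - x j)))"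
    using insert.hyps by simp
  also have "\<dots> = 1 / ((t - x b) * (\<Prod>j\<in>S. x b - x j))
      + ((1 / (t - x b)) * (\<Sum>i\<in>S. 1 / ((t - x i) * ?p i))
        - (1 / (t - x b)) * (\<Sum>i\<in>S. 1 / ((x b - x i) * ?p i)))"
    by (simp only: split sum_subtractf sum_distrib_left cong: sum.cong)
  also have "\<dots> = (1 / (t - x b)) * (1 / (\<Prod>i\<in>S. t - x i))"
    unfolding insert.IH[OF inj t] insert.IH[OF inj b] by simp
  also have "\<dots> = 1 / (\<Prod>i\<in>insert b S. t - x i)"
    using insert.hyps by simp
  finally show ?case .
qed

text \<open>
  The sum is a divided difference: its poles along \<open>x i = x j\<close> cancel because the
  numerators \<open>g i\<close> and \<open>g j\<close> agree there. For the induction a node \<open>a\<close> is split off by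
  writing \<open>g i = g a + (x i - x a) * h i\<close>. The multiples of \<open>g a\<close> cancel by the
  partial fraction expansion, which leaves the divided difference of the \<open>h i\<close> over
  one node less.
\<close>

lemma divided_difference_polynomial:
  assumes "finite S" "\<And>i. i \<in> S \<Longrightarrow> deg_lt d (g i)"
    and "\<And>i j x. \<lbrakk>i \<in> S; j \<in> S; x i = x j\<rbrakk> \<Longrightarrow> g i x = g j x"
  shows "\<exists>G. deg_lt (d - (card S - 1)) G \<and>
    (\<forall>x. inj_on x S \<longrightarrow> G x = (\<Sum>i\<in>S. g i x / (\<Prod>j\<in>S - {i}. x i - x j)))"
proof (cases "S = {}")
  case True
  then show ?thesis by (intro exI[of _ "\<lambda>_. 0"]) (simp add: deg_lt.zero)
next
  case False
  show ?thesis using assms(1) False assms(2,3)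
  proof (induction S arbitrary: d g rule: finite_ne_induct)
    case (singleton a)
    show ?case using singleton.prems(1)[of a] by (intro exI[of _ "g a"]) simp
  next
    case (insert a S)
    have "\<exists>h. deg_lt (d - 1) h \<and> (\<forall>x. g i x = g a x + (x i - x a) * h x)" if i: "i \<in> S" for i
    proof -
      have "deg_lt d (\<lambda>x. g i x - g a x)"
        using insert.prems(1) i by (intro deg_lt_diff) auto
      from deg_lt_division[OF this deg_lt_var[of a], of i]
      obtain h where h: "deg_lt (d - 1) h" "\<And>x. g i x - g a x
          = (g i (x(i := x a)) - g a (x(i := x a))) + (x i - x a) * h x"
        by blast
      moreover have "g i (x(i := x a)) = g a (x(i := x a))" for x
        using insert.hyps i by (intro insert.prems(2)) auto
      ultimately have "g i x = g a x + (x i - x a) * h x" for x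
        using h(2)[of x] by (simp add: algebra_simps)
      then show ?thesis using h(1) by blast
    qed
    then obtain h where h: "\<And>i. i \<in> S \<Longrightarrow> deg_lt (d - 1) (h i)"
      "\<And>i x. i \<in> S \<Longrightarrow> g i x = g a x + (x i - x a) * h i x"
      by metis
    have compat: "h i x = h j x" if ij: "i \<in> S" "j \<in> S" "x i = x j" for i j x
    proof (cases "i = j")
      case False
      have prod0: "(y i - y a) * (h i (y(j := y i)) - h j (y(j := y i))) = 0" for y
      proof -
        let ?y = "y(j := y i)"
        have "g i ?y = g j ?y" using ij False by (intro insert.prems(2)) auto
        then have "(?y i - ?y a) * h i ?y = (?y j - ?y a) * h j ?y"
          using h(2)[of i ?y] h(2)[of j ?y] ij by simp
        moreover have "?y i = y i" "?y j = y i" "?y a = y a"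
          using False ij insert.hyps by auto
        ultimately show ?thesis by (simp add: right_diff_distrib)
      qed
      have deg: "deg_lt (d - 1) (\<lambda>y. h i (y(j := y i)) - h j (y(j := y i)))"
        using ij by (intro deg_lt_diff deg_lt_fun_upd h(1) deg_lt_var)
      have lin: "deg_lt 2 (\<lambda>y. y i - y a)" by (intro deg_lt_linear)
      have "(of_nat i :: 'a) - of_nat a \<noteq> 0" using ij insert.hyps by auto
      from deg_lt_no_zero_divisors[OF lin deg prod0 this]
      have "h i (x(j := x i)) - h j (x(j := x i)) = 0" .
      moreover have "x(j := x i) = x" using ij by auto
      ultimately show ?thesis by simp
    qed auto
    have "\<exists>G. deg_lt (d - 1 - (card S - 1)) G \<and>
        (\<forall>x. inj_on x S \<longrightarrow> G x = (\<Sum>i\<in>S. h i x / (\<Prod>j\<in>S - {i}. x i - x j)))"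
    proof (rule insert.IH)
      show "deg_lt (d - 1) (h i)" if "i \<in> S" for i using that by (rule h(1))
      show "h i x = h j x" if "i \<in> S" "j \<in> S" "x i = x j" for i j x
        using that by (rule compat)
    qed
    then obtain G where G: "deg_lt (d - 1 - (card S - 1)) G"
      "\<And>x. inj_on x S \<Longrightarrow> G x = (\<Sum>i\<in>S. h i x / (\<Prod>j\<in>S - {i}. x i - x j))"
      by blast
    have "G x = (\<Sum>i\<in>insert a S. g i x / (\<Prod>j\<in>insert a S - {i}. x i - x j))"
      if inj: "inj_on x (insert a S)" for x
    proof -
      have a: "x a \<notin> x ` S" and injS: "inj_on x S" using inj insert.hyps by auto
      have split: "g i x / (\<Prod>j\<in>insert a S - {i}. x i - x j)
          = h i x / (\<Prod>j\<in>S - {i}. x i - x j)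
            - g a x * (1 / ((x a - x i) * (\<Prod>j\<in>S - {i}. x i - x j)))" if i: "i \<in> S" for i
      proof -
        have "insert a S - {i} = insert a (S - {i})" using i insert.hyps by auto
        then have *: "(\<Prod>j\<in>insert a S - {i}. x i - x j) = (x i - x a) * (\<Prod>j\<in>S - {i}. x i - x j)"
          using insert.hyps by simp
        have "x i \<noteq> x a" using i a by (metis image_eqI)
        then have "x i - x a \<noteq> 0" "x a - x i \<noteq> 0" by auto
        then have "g i x / ((x i - x a) * P) = h i x / P - g a x * (1 / ((x a - x i) * P))"
          if "P \<noteq> 0" for P
          using that unfolding h(2)[OF i, of x]
          by (simp add: divide_simps) (simp add: algebra_simps)
        moreover have "(\<Prod>j\<in>S - {i}. x i - x j) \<noteq> 0"
          using injS i insert.hyps by (auto simp: inj_on_def)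
        ultimately show ?thesis unfolding * by blast
      qed
      have "(\<Sum>i\<in>insert a S. g i x / (\<Prod>j\<in>insert a S - {i}. x i - x j))
          = g a x / (\<Prod>j\<in>S. x a - x j)
            + (\<Sum>i\<in>S. g i x / (\<Prod>j\<in>insert a S - {i}. x i - x j))"
        using insert.hyps by simp
      also have "\<dots> = g a x / (\<Prod>j\<in>S. x a - x j) + (G x
          - g a x * (\<Sum>i\<in>S. 1 / ((x a - x i) * (\<Prod>j\<in>S - {i}. x i - x j))))"
        unfolding G(2)[OF injS]
        by (simp only: split sum_subtractf sum_distrib_left cong: sum.cong)
      also have "\<dots> = G x"
        unfolding partial_fractions[OF insert.hyps(1) injS a insert.hyps(2)] by simp
      finally show ?thesis by simp
    qed
    moreover have "d - 1 - (card S - 1) = d - (card (insert a S) - 1)"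
      using insert.hyps by (simp add: card_gt_0_iff Suc_leI)
    ultimately show ?case using G(1) by auto
  qed
qed

section \<open>Semisymmetric functions and the evaluation points\<close>

text \<open>
  Invariance under \<open>W n\<close>, which is generated by the transpositions that it
  contains.
\<close>

definition semisym :: "nat \<Rightarrow> ((nat \<Rightarrow> 'k::field_char_0) \<Rightarrow> 'k) \<Rightarrow> bool" where
  "semisym n f \<longleftrightarrow> (\<forall>i\<in>{1..n}. \<forall>j\<in>{1..n}. even i = even j \<longrightarrow>
     (\<forall>x. f (x \<circ> transpose i j) = f x))"

definition depends :: "nat \<Rightarrow> ((nat \<Rightarrow> 'k::field_char_0) \<Rightarrow> 'k) \<Rightarrow> bool" where
  "depends n f \<longleftrightarrow> (\<forall>x y. (\<forall>i\<in>{1..n}. x i = y i) \<longrightarrow> f x = f y)"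

text \<open>
  Another form of the condition that \<open>r\<close> is not a negative rational number, suited
  to the linear expressions in \<open>r\<close> that occur as coordinates and as differences of
  coordinates.
\<close>

definition admissible :: "'k::field_char_0 \<Rightarrow> bool" where
  "admissible r \<longleftrightarrow> (\<forall>a b. 0 < b \<longrightarrow> of_nat a * r + of_nat b \<noteq> 0)"

lemma deg_lt_if: "\<lbrakk>deg_lt d f; deg_lt d g\<rbrakk> \<Longrightarrow> deg_lt d (\<lambda>x. if b then f x else g x)"
  by (cases b) auto

lemma semisymD:
  "\<lbrakk>semisym n f; i \<in> {1..n}; j \<in> {1..n}; even i = even j\<rbrakk> \<Longrightarrow> f (x \<circ> transpose i j) = f x"
  unfolding semisym_def by blast

lemma dependsD: "\<lbrakk>depends n f; \<And>i. i \<in> {1..n} \<Longrightarrow> x i = y i\<rbrakk> \<Longrightarrow> f x = f y"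
  unfolding depends_def by blast

lemma admissibleD: "admissible r \<Longrightarrow> 0 < b \<Longrightarrow> of_nat a * r + of_nat b \<noteq> 0"
  unfolding admissible_def by blast

lemma admissible_of_nat: "admissible (of_nat s)"
  unfolding admissible_def
  by (metis add_is_0 less_irrefl of_nat_0 of_nat_add of_nat_eq_iff of_nat_mult)

lemma admissibleI:
  fixes r :: "'k::field_char_0"
  assumes "\<not> (\<exists>q::rat. q < 0 \<and> r = of_rat q)"
  shows "admissible r"
  unfolding admissible_def
proof (intro allI impI notI)
  fix a b :: nat
  assume b: "0 < b" and eq: "of_nat a * r + of_nat b = 0"
  have a: "0 < a" using b eq by (cases a) auto
  define q :: rat where "q = - (of_nat b / of_nat a)"
  have "q < 0" using a b by (simp add: q_def)
  moreover have "r = - (of_nat b / of_nat a)"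
    using a eq by (simp add: field_simps eq_neg_iff_add_eq_0)
  then have "r = of_rat q" by (simp add: q_def of_rat_minus of_rat_divide)
  ultimately show False using assms by blast
qed

lemma divisible_by_variables:
  assumes "finite S" "deg_lt d f" "\<And>i x. i \<in> S \<Longrightarrow> x i = 0 \<Longrightarrow> f x = 0"
  shows "\<exists>g. deg_lt (d - card S) g \<and> (\<forall>x. f x = (\<Prod>i\<in>S. x i) * g x)"
  using assms(1,3)
proof (induction S rule: finite_induct)
  case empty
  show ?case using assms(2) by (intro exI[of _ f]) simp
next
  case (insert a S)
  then obtain g where g: "deg_lt (d - card S) g" "\<And>x. f x = (\<Prod>i\<in>S. x i) * g x"
    by (metis insertCI)
  have z: "deg_lt 2 (\<lambda>_. 0 :: 'a)" by (rule deg_lt.zero)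
  have "(\<Prod>i\<in>S. x i) * g (x(a := 0)) = 0" for x
  proof -
    have "f (x(a := 0)) = 0" by (rule insert.prems) auto
    moreover have "(\<Prod>i\<in>S. (x(a := 0)) i) = (\<Prod>i\<in>S. x i)"
      using insert.hyps by (intro prod.cong) auto
    ultimately show ?thesis using g(2)[of "x(a := 0)"] by simp
  qed
  moreover have "deg_lt (Suc (card S)) (\<lambda>x. \<Prod>i\<in>S. x i)"
    using insert.hyps by (intro deg_lt_prod_linear deg_lt_var)
  moreover have "(\<Prod>i\<in>S. (\<lambda>_. 1 :: 'a) i) \<noteq> 0" by simp
  ultimately have g0: "g (x(a := 0)) = 0" for x
    using deg_lt_no_zero_divisors[OF _ deg_lt_fun_upd[OF g(1) z, of a], of _ "\<lambda>x. \<Prod>i\<in>S. x i"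
        "\<lambda>_. 1" x]
    by blast
  obtain h where h: "deg_lt (d - card S - 1) h" "\<And>x. g x = g (x(a := 0)) + (x a - 0) * h x"
    using deg_lt_division[OF g(1) z, of a] by blast
  have "f x = (\<Prod>i\<in>insert a S. x i) * h x" for x
    using insert.hyps g(2)[of x] h(2)[of x] g0[of x] by simp
  then show ?case using h(1) insert.hyps by (intro exI[of _ h]) simp
qed

lemma Lam_antimono: "\<lbrakk>mu \<in> Lam n; i \<in> {1..n}; j \<in> {1..n}; i \<le> j\<rbrakk> \<Longrightarrow> mu j \<le> mu i"
  unfolding Lam_def by blast

lemma Lam_outside: "\<lbrakk>mu \<in> Lam n; i \<notin> {1..n}\<rbrakk> \<Longrightarrow> mu i = 0"
  unfolding Lam_def by blast

lemma Lam_Suc: "mu \<in> Lam n \<Longrightarrow> mu \<in> Lam (Suc n)"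
proof -
  assume mu: "mu \<in> Lam n"
  have "mu j \<le> mu i" if "i \<in> {1..Suc n}" "j \<in> {1..Suc n}" "i \<le> j" for i j
    using Lam_antimono[OF mu, of i j] Lam_outside[OF mu, of j] that by (cases "j = Suc n") auto
  moreover have "mu i = 0" if "i \<notin> {1..Suc n}" for i
    using Lam_outside[OF mu, of i] that by auto
  ultimately show "mu \<in> Lam (Suc n)" unfolding Lam_def by blast
qed

lemma odd_size_Suc:
  assumes "mu \<in> Lam n"
  shows "odd_size (Suc n) mu = odd_size n mu"
proof -
  have "mu (Suc n) = 0" using assms by (intro Lam_outside) auto
  moreover have "{i \<in> {1..Suc n}. odd i}
      = (if odd (Suc n) then insert (Suc n) {i \<in> {1..n}. odd i} else {i \<in> {1..n}. odd i})"
    by (auto simp: le_Suc_eq)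
  ultimately show ?thesis unfolding odd_size_def by auto
qed

lemma transpose_in: "\<lbrakk>i \<in> S; j \<in> S; k \<in> S\<rbrakk> \<Longrightarrow> transpose i j k \<in> S"
  by (auto simp: transpose_def)

lemma transpose_out: "\<lbrakk>i \<in> S; j \<in> S; k \<notin> S\<rbrakk> \<Longrightarrow> transpose i j k = k"
  by (auto simp: transpose_def)

definition odds :: "nat \<Rightarrow> nat set" where "odds n = {i \<in> {1..n}. odd i}"

definition evens :: "nat \<Rightarrow> nat set" where "evens n = {i \<in> {1..n}. even i}"

lemma odds_eq_image: "odds n = (\<lambda>k. 2 * k + 1) ` {..<(n + 1) div 2}"
proof
  show "odds n \<subseteq> (\<lambda>k. 2 * k + 1) ` {..<(n + 1) div 2}"
  proof
    fix i assume "i \<in> odds n"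
    then obtain k where "i = 2 * k + 1" "2 * k + 1 \<le> n" by (auto simp: odds_def elim: oddE)
    then show "i \<in> (\<lambda>k. 2 * k + 1) ` {..<(n + 1) div 2}" by (intro image_eqI[of _ _ k]) auto
  qed
qed (auto simp: odds_def)

lemma evens_eq_image: "evens n = (\<lambda>k. 2 * k + 2) ` {..<n div 2}"
proof
  show "evens n \<subseteq> (\<lambda>k. 2 * k + 2) ` {..<n div 2}"
  proof
    fix i assume i: "i \<in> evens n"
    then obtain k where "i = 2 * k" by (auto simp: evens_def elim: evenE)
    with i have "i = 2 * (k - 1) + 2" "k - 1 < n div 2" by (auto simp: evens_def)
    then show "i \<in> (\<lambda>k. 2 * k + 2) ` {..<n div 2}" by (intro image_eqI[of _ _ "k - 1"]) auto
  qed
qed (auto simp: evens_def)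

lemma card_odds: "card (odds n) = (n + 1) div 2"
  unfolding odds_eq_image by (subst card_image) (auto simp: inj_on_def)

lemma card_evens: "card (evens n) = n div 2"
  unfolding evens_eq_image by (subst card_image) (auto simp: inj_on_def)

text \<open>
  Translates the first \<open>n\<close> coordinates by \<open>v\<close> and overwrites all others by those of
  \<open>c\<close>. This serves to restrict a function to fewer variables, to make it independent
  of the coordinates outside \<open>{1..n}\<close>, and to fix the value of the variable with
  index \<open>0\<close>.
\<close>

definition pad :: "nat \<Rightarrow> 'k::field_char_0 \<Rightarrow> (nat \<Rightarrow> 'k) \<Rightarrow> (nat \<Rightarrow> 'k) \<Rightarrow> nat \<Rightarrow> 'k" where
  "pad n v c x i = (if i \<in> {1..n} then x i + v else c i)"

lemma deg_lt_pad: "deg_lt d f \<Longrightarrow> deg_lt d (\<lambda>x. f (pad n v c x))"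
proof -
  assume f: "deg_lt d f"
  have "deg_lt 2 (\<lambda>x. pad n v c x i)" for i
    unfolding pad_def by (intro deg_lt_if deg_lt_linear) simp_all
  then have "deg_lt d (\<lambda>x. f (\<lambda>i. pad n v c x i))" by (rule deg_lt_subst[OF f])
  then show ?thesis by simp
qed

lemma depends_pad: "depends n (\<lambda>x. f (pad n v c x))"
  unfolding depends_def
proof (intro allI impI)
  fix x y :: "nat \<Rightarrow> 'a" assume "\<forall>i\<in>{1..n}. x i = y i"
  then have "pad n v c x = pad n v c y" by (auto simp: pad_def fun_eq_iff)
  then show "f (pad n v c x) = f (pad n v c y)" by simp
qed

lemma semisym_pad:
  assumes "semisym N f" "n \<le> N"
  shows "semisym n (\<lambda>x. f (pad n v c x))"
  unfolding semisym_def
proof (intro ballI impI allI)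
  fix i j and x :: "nat \<Rightarrow> 'a"
  assume ij: "i \<in> {1..n}" "j \<in> {1..n}" "even i = even j"
  have "pad n v c (x \<circ> transpose i j) = pad n v c x \<circ> transpose i j"
  proof
    fix k
    show "pad n v c (x \<circ> transpose i j) k = (pad n v c x \<circ> transpose i j) k"
      using transpose_in[OF ij(1,2), of k] transpose_out[OF ij(1,2), of k]
      by (cases "k \<in> {1..n}") (simp_all add: pad_def del: atLeastAtMost_iff)
  qed
  then show "f (pad n v c (x \<circ> transpose i j)) = f (pad n v c x)"
    by (simp only:) (rule semisymD[OF assms(1)], use ij assms(2) in auto)
qed

section \<open>Uniqueness of the interpolation\<close>

text \<open>
  Induction on \<open>n\<close> and \<open>d\<close>. Setting the last variable to zero gives a function in one
  variable less that vanishes at the corresponding points \<open>\<mu>\<close> with \<open>\<mu>\<^sub>n = 0\<close>, hence is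
  zero. By symmetry \<open>f\<close> is then divisible by the product of all variables whose
  index has the parity of \<open>n\<close>. The quotient, translated by one in every coordinate,
  again satisfies the hypotheses, with a smaller \<open>d\<close>: subtracting one from every
  entry of \<open>\<mu>\<close> lowers \<open>\<bar>\<mu>\<bar>\<close> by the number of odd indices, which for either parity of \<open>n\<close>
  is the number of factors split off.
\<close>

theorem semisym_zero_if_zero_on_shifted:
  fixes r :: "'k::field_char_0"
  assumes r: "admissible r"
  shows "\<lbrakk>deg_lt d f; semisym n f; depends n f;
      \<And>mu. mu \<in> Lam n \<Longrightarrow> odd_size n mu < d \<Longrightarrow> f (shifted n r mu) = 0\<rbrakk> \<Longrightarrow> f x = 0"
proof (induction n arbitrary: d f x)
  case 0
  show ?case
  proof (cases d)
    case 0
    with "0.prems" show ?thesis by (simp add: deg_lt_0)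
  next
    case (Suc d')
    have "f (shifted 0 r (\<lambda>_. 0)) = 0"
      using Suc by (intro "0.prems"(4)) (auto simp: Lam_def odd_size_def)
    moreover have "f x = f (shifted 0 r (\<lambda>_. 0))"
      using "0.prems"(3) by (rule dependsD) auto
    ultimately show ?thesis by simp
  qed
next
  case (Suc n)
  note IHn = Suc.IH
  define N where "N = Suc n"
  define S where "S = {i \<in> {1..N}. even i = even N}"
  have S: "finite S" "N \<in> S" "S \<subseteq> {1..N}" by (auto simp: S_def N_def)
  have "S = odds N" if "odd N" using that by (auto simp: S_def odds_def)
  moreover have "S = evens N" if "even N" using that by (auto simp: S_def evens_def)
  ultimately have card_S: "card S = card (odds N)"
    by (cases "odd N") (auto simp: card_odds card_evens)
  have step: "\<lbrakk>deg_lt d f; semisym N f; depends N f;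
      \<And>mu. mu \<in> Lam N \<Longrightarrow> odd_size N mu < d \<Longrightarrow> f (shifted N r mu) = 0\<rbrakk> \<Longrightarrow> f x = 0"
    for d f x
  proof (induction d arbitrary: f x rule: less_induct)
    case (less d)
    note f = less.prems
    \<comment> \<open>The restriction to \<open>x N = 0\<close>. The translation by \<open>r\<close> accounts for the different vectors \<open>\<rho>\<close>
      in \<open>n\<close> and in \<open>N\<close> variables.\<close>
    define f0 where "f0 = (\<lambda>x. f (pad n r (\<lambda>_. 0) x))"
    have f0_zero: "f0 x = 0" for x
    proof (rule IHn[where f = f0])
      show "deg_lt d f0" unfolding f0_def by (rule deg_lt_pad[OF f(1)])
      show "semisym n f0" unfolding f0_def by (rule semisym_pad[OF f(2)]) (simp add: N_def)
      show "depends n f0" unfolding f0_def by (rule depends_pad)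
      fix mu assume mu: "mu \<in> Lam n" "odd_size n mu < d"
      have "f0 (shifted n r mu) = f (shifted N r mu)"
        unfolding f0_def
      proof (rule dependsD[OF f(3)])
        fix i assume i: "i \<in> {1..N}"
        have "mu N = 0" using mu(1) by (intro Lam_outside) (auto simp: N_def)
        show "pad n r (\<lambda>_. 0) (shifted n r mu) i = shifted N r mu i"
        proof (cases "i \<in> {1..n}")
          case True
          then have "N - i = Suc (n - i)" by (auto simp: N_def)
          with True show ?thesis by (simp add: pad_def shifted_def rho_def distrib_right)
        next
          case False
          with i have "i = N" by (auto simp: N_def)
          with \<open>mu N = 0\<close> False show ?thesis by (auto simp: pad_def shifted_def rho_def)
        qed
      qed
      also have "\<dots> = 0"
      proof (rule f(4))
        show "mu \<in> Lam N" unfolding N_def by (rule Lam_Suc[OF mu(1)])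
        show "odd_size N mu < d" unfolding N_def odd_size_Suc[OF mu(1)] by (rule mu(2))
      qed
      finally show "f0 (shifted n r mu) = 0" .
    qed
    have fN: "f x = 0" if "x N = 0" for x
    proof -
      have "f x = f0 (\<lambda>i. x i - r)"
        unfolding f0_def using that by (intro dependsD[OF f(3)]) (auto simp: pad_def N_def le_Suc_eq)
      then show ?thesis by (simp add: f0_zero)
    qed
    have fS: "f x = 0" if "i \<in> S" "x i = 0" for i x
    proof -
      have "f (x \<circ> transpose i N) = f x"
        using f(2) that S by (intro semisymD) (auto simp: S_def)
      then show ?thesis using fN[of "x \<circ> transpose i N"] that by simp
    qed
    have "\<exists>g. deg_lt (d - card S) g \<and> (\<forall>x. f x = (\<Prod>i\<in>S. x i) * g x)"
      by (rule divisible_by_variables[OF S(1) f(1)]) (rule fS)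
    then obtain g where g: "deg_lt (d - card S) g" "\<And>x. f x = (\<Prod>i\<in>S. x i) * g x" by blast
    define h where "h = (\<lambda>x. g (pad N 1 (\<lambda>_. 0) x))"
    have prod_deg: "deg_lt (Suc (card S)) (\<lambda>x::nat \<Rightarrow> 'k. \<Prod>i\<in>S. x i)"
      using S by (intro deg_lt_prod_linear deg_lt_var)
    have h_deg: "deg_lt (d - card S) h" unfolding h_def by (rule deg_lt_pad[OF g(1)])
    have g_sym: "g (x \<circ> transpose i j) = g x"
      if ij: "i \<in> {1..N}" "j \<in> {1..N}" "even i = even j" for i j x
    proof -
      have deg: "deg_lt (d - card S) (\<lambda>x. g (x \<circ> transpose i j) - g x)"
        unfolding comp_def by (intro deg_lt_diff g(1) deg_lt_subst[OF g(1)] deg_lt_var)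
      have "(\<Prod>i\<in>S. x i) * (g (x \<circ> transpose i j) - g x) = 0" for x
      proof -
        have "bij_betw (transpose i j) S S"
        proof (cases "i \<in> S")
          case True
          with ij have "j \<in> S" by (auto simp: S_def)
          with True show ?thesis by (metis permutes_swap_id permutes_imp_bij)
        next
          case False
          with ij have "j \<notin> S" by (auto simp: S_def)
          with False have "bij_betw (transpose i j) S S = bij_betw id S S"
            by (intro bij_betw_cong) (auto simp: transpose_def)
          then show ?thesis by simp
        qed
        from prod.reindex_bij_betw[OF this, of x]
        have "(\<Prod>k\<in>S. (x \<circ> transpose i j) k) = (\<Prod>k\<in>S. x k)" by simp
        with g(2)[of "x \<circ> transpose i j"] g(2)[of x] semisymD[OF f(2) ij, of x]
        show ?thesis by (auto simp: right_diff_distrib)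
      qed
      then have "g (x \<circ> transpose i j) - g x = 0"
        by (rule deg_lt_no_zero_divisors[OF prod_deg deg, where a = "\<lambda>_. 1"]) simp
      then show ?thesis by simp
    qed
    then have g_semisym: "semisym N g" unfolding semisym_def by blast
    have h_zero: "h x = 0" for x
    proof (cases "d = 0")
      case True
      then show ?thesis using h_deg by (simp add: deg_lt_0)
    next
      case False
      have "0 < card S" using S by (auto simp: card_gt_0_iff)
      with False have "d - card S < d" by simp
      then show ?thesis
      proof (rule less.IH[where f = h, OF _ h_deg])
        show "semisym N h" unfolding h_def by (rule semisym_pad[OF g_semisym]) simp
        show "depends N h" unfolding h_def by (rule depends_pad)
        fix mu assume mu: "mu \<in> Lam N" "odd_size N mu < d - card S"
        define nu where "nu = (\<lambda>i. if i \<in> {1..N} then Suc (mu i) else 0)"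
        have nu: "nu \<in> Lam N" using mu(1) by (auto simp: nu_def Lam_def)
        have "odd_size N nu = odd_size N mu + card S"
          unfolding odd_size_def nu_def card_S
          by (simp add: sum_Suc odds_def)
        with mu(2) have "odd_size N nu < d" by linarith
        with nu have f_nu: "f (shifted N r nu) = 0" by (rule f(4))
        define y where "y = (\<lambda>i. if i \<in> {1..N} then shifted N r nu i else 0)"
        have "f y = f (shifted N r nu)"
          using f(3) by (rule dependsD) (auto simp: y_def)
        then have "(\<Prod>i\<in>S. y i) * g y = 0" using f_nu g(2)[of y] by simp
        moreover have "y i \<noteq> 0" if "i \<in> S" for i
        proof -
          have "y i = of_nat (N - i) * r + of_nat (Suc (mu i))"
            using that S by (auto simp: y_def shifted_def rho_def nu_def)
          then show ?thesis using admissibleD[OF r, of "Suc (mu i)" "N - i"] by simp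
        qed
        ultimately have "g y = 0" using S(1) by simp
        moreover have "y = pad N 1 (\<lambda>_. 0) (shifted N r mu)"
          by (auto simp: pad_def y_def shifted_def nu_def)
        ultimately show "h (shifted N r mu) = 0" by (simp add: h_def)
      qed
    qed
    let ?x = "\<lambda>i. if i \<in> {1..N} then x i else 0"
    have "f x = f ?x" using f(3) by (rule dependsD) auto
    also have "\<dots> = (\<Prod>i\<in>S. ?x i) * g ?x" by (rule g(2))
    also have "g ?x = h (\<lambda>i. x i - 1)"
      unfolding h_def by (rule arg_cong[of _ _ g]) (auto simp: pad_def)
    finally show "f x = 0" by (simp add: h_zero)
  qed
  show ?case
    by (rule step[where f = f and d = d, unfolded N_def]; rule Suc.prems)
qed

section \<open>From formal polynomials to polynomial functions\<close>

lemma eval_poly_superset: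
  assumes "finite K" "Poly_Mapping.keys p \<subseteq> K"
  shows "eval_poly p x = (\<Sum>m\<in>K. Poly_Mapping.lookup p m *
      (\<Prod>i\<in>Poly_Mapping.keys m. x i ^ Poly_Mapping.lookup m i))"
  unfolding eval_poly_def
proof (rule sum.mono_neutral_left[OF assms], rule ballI)
  fix m assume "m \<in> K - Poly_Mapping.keys p"
  then have "Poly_Mapping.lookup p m = 0" by (metis DiffD2 in_keys_iff)
  then show "Poly_Mapping.lookup p m * (\<Prod>i\<in>Poly_Mapping.keys m. x i ^ Poly_Mapping.lookup m i) = 0"
    by simp
qed

lemma eval_poly_add: "eval_poly (p + q) x = eval_poly p x + eval_poly q x"
proof -
  let ?K = "Poly_Mapping.keys p \<union> Poly_Mapping.keys q"
  have "Poly_Mapping.keys (p + q) \<subseteq> ?K" by (rule Poly_Mapping.keys_add)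
  then show ?thesis
    by (simp add: eval_poly_superset[of ?K] lookup_add distrib_right sum.distrib)
qed

lemma eval_poly_zero: "eval_poly 0 x = 0"
  by (simp add: eval_poly_def)

lemma eval_poly_sum: "eval_poly (\<Sum>a\<in>A. p a) x = (\<Sum>a\<in>A. eval_poly (p a) x)"
proof (induction A rule: infinite_finite_induct)
  case (insert a A)
  then show ?case by (simp add: eval_poly_add)
qed (simp_all add: eval_poly_zero)

lemma eval_poly_single:
  "eval_poly (Poly_Mapping.single m c) x = c * (\<Prod>i\<in>Poly_Mapping.keys m. x i ^ Poly_Mapping.lookup m i)"
  by (subst eval_poly_superset[of "{m}"]) auto

lemma eval_permute_vars:
  assumes "bij \<pi>"
  shows "eval_poly (permute_vars \<pi> p) x = eval_poly p (x \<circ> \<pi>)"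
proof -
  have "(\<Prod>i\<in>Poly_Mapping.keys (Poly_Mapping.map_key (inv \<pi>) m).
      x i ^ Poly_Mapping.lookup (Poly_Mapping.map_key (inv \<pi>) m) i)
      = (\<Prod>i\<in>Poly_Mapping.keys m. x (\<pi> i) ^ Poly_Mapping.lookup m i)" for m :: monomial
  proof -
    have inj: "inj (inv \<pi>)" using assms by (simp add: bij_imp_bij_inv bij_is_inj)
    have lookup: "Poly_Mapping.lookup (Poly_Mapping.map_key (inv \<pi>) m) i = Poly_Mapping.lookup m (inv \<pi> i)" for i
      using inj by (simp add: map_key.rep_eq)
    have keys: "Poly_Mapping.keys (Poly_Mapping.map_key (inv \<pi>) m) = \<pi> ` Poly_Mapping.keys m"
      using assms inj by (simp add: keys_map_key bij_vimage_eq_inv_image bij_imp_bij_inv inv_inv_eq)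
    have "inj_on \<pi> (Poly_Mapping.keys m)" using assms by (metis bij_is_inj inj_on_subset subset_UNIV)
    then show ?thesis
      unfolding keys using assms by (simp add: prod.reindex lookup bij_is_inj)
  qed
  then show ?thesis
    unfolding permute_vars_def eval_poly_sum eval_poly_single
    by (simp add: eval_poly_def[of p])
qed

lemma deg_lt_eval_poly: "deg_lt (Suc (total_degree p)) (eval_poly p)"
proof -
  have mon: "deg_lt (Suc (\<Sum>i\<in>K. e i)) (\<lambda>x::nat \<Rightarrow> 'a. \<Prod>i\<in>K. x i ^ e i)" if "finite K" for K and e :: "nat \<Rightarrow> nat"
    using that
  proof (induction K rule: finite_induct)
    case empty
    then show ?case by (simp add: deg_lt.const)
  next
    case (insert a K)
    have "deg_lt (Suc k) (\<lambda>x::nat \<Rightarrow> 'a. x a ^ k)" for k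
    proof (induction k)
      case 0
      show ?case using deg_lt.const by simp
    next
      case (Suc k)
      then show ?case using deg_lt.var[of "Suc k" "\<lambda>x. x a ^ k" a] by simp
    qed
    from deg_lt_mult[OF this[of "e a"] insert.IH] show ?case using insert.hyps by simp
  qed
  show ?thesis unfolding eval_poly_def
  proof (intro deg_lt_sum deg_lt_scale)
    fix m assume "m \<in> Poly_Mapping.keys p"
    then have "monomial_degree m \<le> total_degree p"
      unfolding total_degree_def by (intro Max_ge) auto
    moreover have "deg_lt (Suc (monomial_degree m))
        (\<lambda>x::nat \<Rightarrow> 'a. \<Prod>i\<in>Poly_Mapping.keys m. x i ^ Poly_Mapping.lookup m i)"
      unfolding monomial_degree_def by (rule mon) simp
    ultimately show "deg_lt (Suc (total_degree p))
        (\<lambda>x::nat \<Rightarrow> 'a. \<Prod>i\<in>Poly_Mapping.keys m. x i ^ Poly_Mapping.lookup m i)"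
      by (elim deg_lt_mono) simp
  qed
qed

lemma depends_eval_poly:
  assumes "p \<in> polys n"
  shows "depends n (eval_poly p)"
  unfolding depends_def
proof (intro allI impI)
  fix x y :: "nat \<Rightarrow> 'a"
  assume xy: "\<forall>i\<in>{1..n}. x i = y i"
  have "(\<Prod>i\<in>Poly_Mapping.keys m. x i ^ Poly_Mapping.lookup m i)
      = (\<Prod>i\<in>Poly_Mapping.keys m. y i ^ Poly_Mapping.lookup m i)"
    if "m \<in> Poly_Mapping.keys p" for m
  proof (rule prod.cong)
    fix i assume "i \<in> Poly_Mapping.keys m"
    with assms that have "i \<in> {1..n}" unfolding polys_def by blast
    with xy show "x i ^ Poly_Mapping.lookup m i = y i ^ Poly_Mapping.lookup m i" by simp
  qed simp
  then show "eval_poly p x = eval_poly p y"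
    unfolding eval_poly_def by (intro sum.cong refl) simp
qed

lemma semisym_eval_poly:
  assumes "p \<in> invariant_polys n"
  shows "semisym n (eval_poly p)"
  unfolding semisym_def
proof (intro ballI impI allI)
  fix i j and x :: "nat \<Rightarrow> 'a"
  assume ij: "i \<in> {1..n}" "j \<in> {1..n}" "even i = even j"
  have "[transpose i j k = k] (mod 2)" for k
    using ij(3) by (cases "k = i"; cases "k = j") (simp_all add: cong_def mod2_eq_if)
  then have "transpose i j \<in> W n"
    unfolding W_def using permutes_swap_id[OF ij(1,2)] by blast
  then have "permute_vars (transpose i j) p = p" using assms by (auto simp: invariant_polys_def)
  then show "eval_poly p (x \<circ> transpose i j) = eval_poly p x"
    using eval_permute_vars[of "transpose i j" p x] by simp
qed

section \<open>The difference operator on polynomials\<close>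

text \<open>
  The variable \<open>x 0\<close> stands for the parameter \<open>r\<close>. The degree bounds then count the
  parameter with degree \<open>1\<close>, and they remain valid when it is replaced by a
  constant.
\<close>

definition shifted_gap_prod :: "nat set \<Rightarrow> nat \<Rightarrow> (nat \<Rightarrow> 'k::field_char_0) \<Rightarrow> 'k" where
  "shifted_gap_prod S i x = (\<Prod>c\<in>S. x i - x c - x 0)"

definition gap_prod :: "nat set \<Rightarrow> nat \<Rightarrow> (nat \<Rightarrow> 'k::field_char_0) \<Rightarrow> 'k" where
  "gap_prod S i x = (\<Prod>c\<in>S - {i}. x i - x c)"

definition double_sum :: "nat \<Rightarrow> (nat \<Rightarrow> (nat \<Rightarrow> 'k::field_char_0) \<Rightarrow> 'k) \<Rightarrow>
    (nat \<Rightarrow> nat \<Rightarrow> (nat \<Rightarrow> 'k) \<Rightarrow> 'k) \<Rightarrow> (nat \<Rightarrow> 'k) \<Rightarrow> 'k" where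
  "double_sum n A B x =
     (\<Sum>i\<in>odds n. (A i x + (\<Sum>j\<in>evens n. B i j x / gap_prod (evens n) j x)) / gap_prod (odds n) i x)"

lemma finite_odds [simp]: "finite (odds n)" and finite_evens [simp]: "finite (evens n)"
  by (simp_all add: odds_def evens_def)

lemma odds_subset: "odds n \<subseteq> {1..n}" and evens_subset: "evens n \<subseteq> {1..n}"
  by (auto simp: odds_def evens_def)

text \<open>
  The transpositions in \<open>W n\<close>.
\<close>

definition same_parity :: "nat \<Rightarrow> nat \<Rightarrow> nat \<Rightarrow> bool" where
  "same_parity n a b \<longleftrightarrow> a \<in> {1..n} \<and> b \<in> {1..n} \<and> even a = even b"

lemma same_parity_transpose:
  assumes "same_parity n a b"
  shows "transpose a b i \<in> odds n \<longleftrightarrow> i \<in> odds n"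
    and "transpose a b i \<in> evens n \<longleftrightarrow> i \<in> evens n"
  using assms by (auto simp: same_parity_def odds_def evens_def transpose_def)

lemma bij_betw_transpose_odds: "same_parity n a b \<Longrightarrow> bij_betw (transpose a b) (odds n) (odds n)"
  by (rule bij_betw_byWitness[where f' = "transpose a b"]) (auto simp: same_parity_transpose)

lemma bij_betw_transpose_evens: "same_parity n a b \<Longrightarrow> bij_betw (transpose a b) (evens n) (evens n)"
  by (rule bij_betw_byWitness[where f' = "transpose a b"]) (auto simp: same_parity_transpose)

lemma shifted_gap_prod_permute:
  assumes "same_parity n a b"
  shows "shifted_gap_prod S i (x \<circ> transpose a b) = shifted_gap_prod (transpose a b ` S) (transpose a b i) x"
proof -
  have "transpose a b 0 = 0" using assms by (auto simp: same_parity_def transpose_def)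
  then show ?thesis by (simp add: shifted_gap_prod_def prod.reindex)
qed

lemma gap_prod_permute: "gap_prod S i (x \<circ> transpose a b) = gap_prod (transpose a b ` S) (transpose a b i) x"
proof -
  have "transpose a b ` S - {transpose a b i} = transpose a b ` (S - {i})"
    by (simp add: image_set_diff)
  then show ?thesis by (simp add: gap_prod_def prod.reindex)
qed

lemma deg_lt_shifted_gap_prod:
  assumes "finite S"
  shows "deg_lt (Suc (card S)) (shifted_gap_prod S i)"
proof -
  have "deg_lt (Suc (card S)) (\<lambda>x::nat \<Rightarrow> 'a. \<Prod>c\<in>S. x i - x c - x 0)"
    using assms by (intro deg_lt_prod_linear deg_lt_linear)
  then show ?thesis by (simp add: shifted_gap_prod_def[abs_def])
qed

lemma comp_transpose_eq: "x a = x b \<Longrightarrow> x \<circ> transpose a b = x"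
  by (auto simp: fun_eq_iff transpose_def)

text \<open>
  The inner sums are divided differences over the even variables, and the outer
  sum is one over the odd variables. The equivariance of the numerators makes them
  agree where two coordinates agree, because such a point is fixed by the
  transposition.
\<close>

lemma double_sum_polynomial:
  fixes A :: "nat \<Rightarrow> (nat \<Rightarrow> 'k::field_char_0) \<Rightarrow> 'k"
  assumes degA: "\<And>i. i \<in> odds n \<Longrightarrow> deg_lt (e + card (odds n)) (A i)"
    and degB: "\<And>i j. \<lbrakk>i \<in> odds n; j \<in> evens n\<rbrakk> \<Longrightarrow>
      deg_lt (e + card (odds n) + (card (evens n) - 1)) (B i j)"
    and symA: "\<And>a b i x. \<lbrakk>same_parity n a b; i \<in> odds n\<rbrakk> \<Longrightarrow>
      A i (x \<circ> transpose a b) = A (transpose a b i) x"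
    and symB: "\<And>a b i j x. \<lbrakk>same_parity n a b; i \<in> odds n; j \<in> evens n\<rbrakk> \<Longrightarrow>
      B i j (x \<circ> transpose a b) = B (transpose a b i) (transpose a b j) x"
  shows "\<exists>G. deg_lt (Suc e) G \<and> semisym n G \<and> (\<forall>x. inj_on x {1..n} \<longrightarrow> G x = double_sum n A B x)"
proof -
  have "\<exists>H. deg_lt (e + card (odds n)) H \<and>
      (\<forall>x. inj_on x (evens n) \<longrightarrow> H x = (\<Sum>j\<in>evens n. B i j x / gap_prod (evens n) j x))"
    if i: "i \<in> odds n" for i
  proof -
    have compat: "B i j x = B i j' x" if j: "j \<in> evens n" "j' \<in> evens n" "x j = x j'" for j j' x
    proof -
      have p: "same_parity n j j'" using j by (auto simp: same_parity_def evens_def)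
      have "transpose j j' i = i" using i j by (auto simp: transpose_def odds_def evens_def)
      with symB[OF p i j(1), of x] show ?thesis by (simp add: comp_transpose_eq[of x, OF j(3)])
    qed
    have "\<exists>H. deg_lt (e + card (odds n) + (card (evens n) - 1) - (card (evens n) - 1)) H \<and>
        (\<forall>x. inj_on x (evens n) \<longrightarrow> H x = (\<Sum>j\<in>evens n. B i j x / (\<Prod>c\<in>evens n - {j}. x j - x c)))"
      by (rule divided_difference_polynomial) (simp, rule degB[OF i], assumption, rule compat)
    then show ?thesis unfolding gap_prod_def by simp
  qed
  then obtain H where H: "\<And>i. i \<in> odds n \<Longrightarrow> deg_lt (e + card (odds n)) (H i)"
    "\<And>i x. \<lbrakk>i \<in> odds n; inj_on x (evens n)\<rbrakk> \<Longrightarrow>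
      H i x = (\<Sum>j\<in>evens n. B i j x / gap_prod (evens n) j x)"
    by metis
  define K where "K i x = A i x + H i x" for i x
  have degK: "deg_lt (e + card (odds n)) (K i)" if "i \<in> odds n" for i
    unfolding K_def using that by (intro deg_lt.add degA H(1))
  have compatK: "K i x = K i' x" if i: "i \<in> odds n" "i' \<in> odds n" "x i = x i'" for i i' x
  proof -
    have p: "same_parity n i i'" using i by (auto simp: same_parity_def odds_def)
    \<comment> \<open>The sums are known only where the even coordinates are distinct; density within the hyperplane gives the
      remaining points.\<close>
    have inj: "K i y = K i' y" if y: "y i = y i'" "inj_on y (evens n)" for y
    proof -
      have "A i y = A i' y" using symA[OF p i(1), of y] by (simp add: comp_transpose_eq[of y, OF y(1)])
      moreover have "B i j y = B i' j y" if j: "j \<in> evens n" for j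
      proof -
        have "transpose i i' j = j" using i j by (auto simp: transpose_def odds_def evens_def)
        then show ?thesis using symB[OF p i(1) j, of y] by (simp add: comp_transpose_eq[of y, OF y(1)])
      qed
      ultimately show ?thesis using H(2)[OF i(1) y(2)] H(2)[OF i(2) y(2)] by (simp add: K_def)
    qed
    have "deg_lt (e + card (odds n)) (\<lambda>y. K i (y(i' := y i)) - K i' (y(i' := y i)))"
      using i by (intro deg_lt_diff deg_lt_fun_upd degK deg_lt_var)
    moreover have "finite (evens n)" by simp
    moreover have "K i (y(i' := y i)) - K i' (y(i' := y i)) = 0" if "inj_on y (evens n)" for y
    proof -
      have "i' \<notin> evens n" using i by (auto simp: odds_def evens_def)
      with that have "inj_on (y(i' := y i)) (evens n)"
        by (metis inj_on_cong fun_upd_other)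
      from inj[OF _ this] show ?thesis by simp
    qed
    ultimately have "K i (x(i' := x i)) - K i' (x(i' := x i)) = 0"
      by (rule deg_lt_zero_if_zero_on_inj)
    moreover have "x(i' := x i) = x" using i(3) by auto
    ultimately show ?thesis by simp
  qed
  have "\<exists>G. deg_lt (e + card (odds n) - (card (odds n) - 1)) G \<and>
      (\<forall>x. inj_on x (odds n) \<longrightarrow> G x = (\<Sum>i\<in>odds n. K i x / (\<Prod>c\<in>odds n - {i}. x i - x c)))"
    by (rule divided_difference_polynomial) (simp, rule degK, assumption, rule compatK)
  then obtain G where G: "deg_lt (e + card (odds n) - (card (odds n) - 1)) G"
    "\<And>x. inj_on x (odds n) \<Longrightarrow> G x = (\<Sum>i\<in>odds n. K i x / gap_prod (odds n) i x)"
    unfolding gap_prod_def by blast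
  have degG: "deg_lt (Suc e) G" using G(1) by (rule deg_lt_mono) simp
  have valG: "G x = double_sum n A B x" if x: "inj_on x {1..n}" for x
  proof -
    have "inj_on x (odds n)" "inj_on x (evens n)"
      by (rule inj_on_subset[OF x odds_subset], rule inj_on_subset[OF x evens_subset])
    then show ?thesis unfolding double_sum_def by (simp add: G(2) K_def H(2))
  qed
  have "G (x \<circ> transpose a b) - G x = 0" if p: "same_parity n a b" for a b x
  proof (rule deg_lt_zero_if_zero_on_inj[where f = "\<lambda>x. G (x \<circ> transpose a b) - G x" and S = "{1..n}"])
    show "deg_lt (Suc e) (\<lambda>x. G (x \<circ> transpose a b) - G x)"
      unfolding comp_def by (rule deg_lt_diff[OF deg_lt_subst[OF degG deg_lt_var] degG])
    fix x :: "nat \<Rightarrow> 'k"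
    assume x: "inj_on x {1..n}"
    have "inj_on (x \<circ> transpose a b) {1..n}"
    proof (rule comp_inj_on)
      have "transpose a b ` {1..n} \<subseteq> {1..n}" using p
        by (auto simp: same_parity_def transpose_def)
      then show "inj_on x (transpose a b ` {1..n})" using x by (rule inj_on_subset[rotated])
    qed simp
    then have "G (x \<circ> transpose a b) = double_sum n A B (x \<circ> transpose a b)" by (rule valG)
    also have "\<dots> = (\<Sum>i\<in>odds n. (A (transpose a b i) x
        + (\<Sum>j\<in>evens n. B (transpose a b i) (transpose a b j) x / gap_prod (evens n) (transpose a b j) x))
          / gap_prod (odds n) (transpose a b i) x)"
      unfolding double_sum_def gap_prod_permute
      using bij_betw_imp_surj_on[OF bij_betw_transpose_odds[OF p]]
        bij_betw_imp_surj_on[OF bij_betw_transpose_evens[OF p]]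
      by (intro sum.cong refl arg_cong2[of _ _ _ _ "(/)"] arg_cong2[of _ _ _ _ "(+)"] symA[OF p] symB[OF p])
        simp_all
    also have "\<dots> = (\<Sum>i\<in>odds n. (A (transpose a b i) x
        + (\<Sum>j\<in>evens n. B (transpose a b i) j x / gap_prod (evens n) j x)) / gap_prod (odds n) (transpose a b i) x)"
      by (simp only: sum.reindex_bij_betw[OF bij_betw_transpose_evens[OF p],
            of "\<lambda>j. B (transpose a b _) j x / gap_prod (evens n) j x"])
    also have "\<dots> = double_sum n A B x"
      unfolding double_sum_def by (rule sum.reindex_bij_betw[OF bij_betw_transpose_odds[OF p]])
    also have "\<dots> = G x" using x by (rule valG[symmetric])
    finally show "G (x \<circ> transpose a b) - G x = 0" by simp
  qed simp
  then have "semisym n G" unfolding semisym_def same_parity_def by simp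
  with degG valG show ?thesis by blast
qed

text \<open>
  The numerators of the coefficients belonging to the steps \<open>e\<^sub>i\<close> and \<open>e\<^sub>i + e\<^sub>j\<close>. The
  extra linear factor forbids a step that would make the last entry negative: this
  factor is \<open>x i\<close> if \<open>n\<close> is odd, and \<open>x j\<close> if \<open>n\<close> is even; in the latter case a step \<open>e\<^sub>i\<close>
  leaves the last entry unchanged.
\<close>

definition single_num :: "nat \<Rightarrow> nat \<Rightarrow> (nat \<Rightarrow> 'k::field_char_0) \<Rightarrow> 'k" where
  "single_num n i x = (if odd n then x i else 1) * shifted_gap_prod (evens n) i x"

definition pair_num :: "nat \<Rightarrow> nat \<Rightarrow> nat \<Rightarrow> (nat \<Rightarrow> 'k::field_char_0) \<Rightarrow> 'k" where
  "pair_num n i j x = (if odd n then x i else x j) *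
     (shifted_gap_prod (evens n - {j}) i x * shifted_gap_prod (odds n - {i}) j x)"

text \<open>
  With \<open>g T x = f x - f (x - e\<^sub>T)\<close>, where \<open>e\<^sub>T\<close> is the indicator vector of \<open>T\<close>, this is
  the operator \<open>E\<close> applied to \<open>f\<close>; with \<open>g = 1\<close> it is the sum of all coefficients.
\<close>

definition weighted_sum :: "nat \<Rightarrow> (nat set \<Rightarrow> (nat \<Rightarrow> 'k::field_char_0) \<Rightarrow> 'k) \<Rightarrow> (nat \<Rightarrow> 'k) \<Rightarrow> 'k" where
  "weighted_sum n g =
     double_sum n (\<lambda>i x. single_num n i x * g {i} x) (\<lambda>i j x. pair_num n i j x * g {i, j} x)"

text \<open>
  The numerator for \<open>e\<^sub>i\<close> has degree \<open>card (odds n)\<close>, one more than its denominator,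
  and the same excess occurs for \<open>e\<^sub>i + e\<^sub>j\<close>. So the degree grows by one.
\<close>

lemma weighted_sum_polynomial:
  fixes g :: "nat set \<Rightarrow> (nat \<Rightarrow> 'k::field_char_0) \<Rightarrow> 'k"
  assumes deg: "\<And>T. deg_lt e (g T)"
    and sym: "\<And>a b T x. same_parity n a b \<Longrightarrow> g T (x \<circ> transpose a b) = g (transpose a b ` T) x"
  shows "\<exists>G. deg_lt (Suc e) G \<and> semisym n G \<and> (\<forall>x. inj_on x {1..n} \<longrightarrow> G x = weighted_sum n g x)"
  unfolding weighted_sum_def
proof (rule double_sum_polynomial)
  fix i assume i: "i \<in> odds n"
  have one: "deg_lt (Suc (card (evens n))) (\<lambda>x::nat \<Rightarrow> 'k. shifted_gap_prod (evens n) i x)"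
    by (rule deg_lt_shifted_gap_prod) simp
  have "deg_lt (Suc (card (odds n))) (single_num n i :: (nat \<Rightarrow> 'k) \<Rightarrow> 'k)"
  proof (cases "odd n")
    case True
    then have "card (odds n) = Suc (card (evens n))" by (auto simp: card_odds card_evens elim: oddE)
    then show ?thesis using True deg_lt_mult_linear[OF one deg_lt_var[of i]]
      by (simp add: single_num_def[abs_def])
  next
    case False
    then have "card (odds n) = card (evens n)" by (auto simp: card_odds card_evens elim: evenE)
    then show ?thesis using False one by (simp add: single_num_def[abs_def])
  qed
  from deg_lt_mult[OF deg[of "{i}"] this]
  show "deg_lt (e + card (odds n)) (\<lambda>x. single_num n i x * g {i} x)" by (simp add: mult.commute)
  fix j assume j: "j \<in> evens n"
  have pos: "card (odds n) = Suc (card (odds n - {i}))" "card (evens n) = Suc (card (evens n - {j}))"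
    using i j card_Suc_Diff1[of "odds n" i] card_Suc_Diff1[of "evens n" j] by (simp_all only: finite_odds finite_evens)
  have "deg_lt (Suc (card (evens n - {j})) + card (odds n - {i}))
      (\<lambda>x::nat \<Rightarrow> 'k. shifted_gap_prod (evens n - {j}) i x * shifted_gap_prod (odds n - {i}) j x)"
    by (intro deg_lt_mult deg_lt_shifted_gap_prod) auto
  moreover have "deg_lt 2 (\<lambda>x::nat \<Rightarrow> 'k. if odd n then x i else x j)"
    by (intro deg_lt_if deg_lt_var)
  ultimately have "deg_lt (Suc (Suc (card (evens n - {j})) + card (odds n - {i})))
      (pair_num n i j :: (nat \<Rightarrow> 'k) \<Rightarrow> 'k)"
    unfolding pair_num_def[abs_def] by (rule deg_lt_mult_linear)
  then have "deg_lt (Suc (card (odds n) + (card (evens n) - 1))) (pair_num n i j :: (nat \<Rightarrow> 'k) \<Rightarrow> 'k)"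
    using pos by (simp add: add.commute)
  from deg_lt_mult[OF deg[of "{i, j}"] this]
  show "deg_lt (e + card (odds n) + (card (evens n) - 1)) (\<lambda>x. pair_num n i j x * g {i, j} x)"
    by (simp add: mult.commute add.assoc)
next
  fix a b i x assume p: "same_parity n a b" and i: "i \<in> odds n"
  have evens: "transpose a b ` evens n = evens n"
    by (rule bij_betw_imp_surj_on[OF bij_betw_transpose_evens[OF p]])
  show "single_num n i (x \<circ> transpose a b) * g {i} (x \<circ> transpose a b)
      = single_num n (transpose a b i) x * g {transpose a b i} x"
    by (simp add: single_num_def shifted_gap_prod_permute[OF p] evens sym[OF p])
  fix j assume j: "j \<in> evens n"
  have odds: "transpose a b ` odds n = odds n"
    by (rule bij_betw_imp_surj_on[OF bij_betw_transpose_odds[OF p]])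
  have "transpose a b ` (evens n - {j}) = evens n - {transpose a b j}"
    "transpose a b ` (odds n - {i}) = odds n - {transpose a b i}"
    using evens odds by (simp_all add: image_set_diff)
  then show "pair_num n i j (x \<circ> transpose a b) * g {i, j} (x \<circ> transpose a b)
      = pair_num n (transpose a b i) (transpose a b j) x * g {transpose a b i, transpose a b j} x"
    by (simp add: pair_num_def shifted_gap_prod_permute[OF p] sym[OF p])
qed

section \<open>The coefficients at the lattice points\<close>

definition lower :: "(nat \<Rightarrow> nat) \<Rightarrow> nat set \<Rightarrow> nat \<Rightarrow> nat" where
  "lower mu T i = (if i \<in> T then mu i - 1 else mu i)"

definition lowerable :: "nat \<Rightarrow> (nat \<Rightarrow> nat) \<Rightarrow> nat set \<Rightarrow> bool" where
  "lowerable n mu T \<longleftrightarrow> (\<forall>i\<in>T. 0 < mu i) \<and> lower mu T \<in> Lam n"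

text \<open>
  The point \<open>\<rho> + \<mu>\<close> for the parameter value \<open>s\<close>, together with the parameter itself
  at index \<open>0\<close>.
\<close>

definition lattice_point :: "nat \<Rightarrow> 'k::field_char_0 \<Rightarrow> (nat \<Rightarrow> nat) \<Rightarrow> nat \<Rightarrow> 'k" where
  "lattice_point n s mu i = (if i = 0 then s else shifted n s mu i)"

lemma pad_shifted:
  assumes "mu \<in> Lam n"
  shows "pad n 0 (\<lambda>i. if i = 0 then s else 0) (shifted n s mu) = lattice_point n s mu"
  using Lam_outside[OF assms]
  by (auto simp: fun_eq_iff pad_def lattice_point_def shifted_def rho_def)

lemma lattice_point_pos: "0 < i \<Longrightarrow> lattice_point n s mu i = of_nat (n - i) * s + of_nat (mu i)"
  by (simp add: lattice_point_def shifted_def rho_def)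

lemma lattice_point_0: "lattice_point n s mu 0 = s"
  by (simp add: lattice_point_def)

lemma lattice_point_diff:
  assumes "0 < i" "i \<le> j" "j \<le> n"
  shows "lattice_point n s mu i - lattice_point n s mu j
    = of_nat (j - i) * s + (of_nat (mu i) - of_nat (mu j))"
proof -
  have "n - i = (n - j) + (j - i)" using assms by simp
  then have "(of_nat (n - i) :: 'a) = of_nat (n - j) + of_nat (j - i)" by (simp only: of_nat_add)
  then show ?thesis using assms by (simp add: lattice_point_pos algebra_simps)
qed

text \<open>
  For a positive integer parameter the coordinates are strictly decreasing, so
  that no denominator vanishes.
\<close>

lemma lattice_point_inj:
  assumes "mu \<in> Lam n" "0 < t"
  shows "inj_on (lattice_point n (of_nat t :: 'k::field_char_0) mu) {1..n}"
proof (rule linorder_inj_onI)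
  fix i j assume ij: "i < j" "i \<in> {1..n}" "j \<in> {1..n}"
  have "mu j \<le> mu i" using ij by (intro Lam_antimono[OF assms(1)]) auto
  then have "lattice_point n (of_nat t) mu i - lattice_point n (of_nat t) mu j
      = (of_nat ((j - i) * t + (mu i - mu j)) :: 'k)"
    using ij by (subst lattice_point_diff) (auto simp: of_nat_diff)
  also have "\<dots> \<noteq> 0" using ij assms(2) by (simp only: of_nat_eq_0_iff) simp
  finally show "lattice_point n (of_nat t :: 'k) mu i \<noteq> lattice_point n (of_nat t) mu j" by auto
qed auto

lemma gap_prod_nonzero:
  assumes "inj_on x {1..n}" "S \<subseteq> {1..n}" "i \<in> {1..n}"
  shows "gap_prod S i x \<noteq> 0"
proof -
  have "finite S" using assms(2) by (rule finite_subset) simp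
  moreover have "x i \<noteq> x c" if "c \<in> S - {i}" for c
    using that assms by (metis DiffE inj_onD insertI1 subsetD)
  ultimately show ?thesis unfolding gap_prod_def by simp
qed

text \<open>
  The two ways in which subtracting \<open>1\<close> at the indices in \<open>T\<close> can leave \<open>Lam n\<close>: two
  equal neighbours would get out of order, or the last entry would become
  negative.
\<close>

lemma not_lowerable:
  assumes mu: "mu \<in> Lam n" and T: "T \<subseteq> {1..n}" and not: "\<not> lowerable n mu T"
  shows "(\<exists>i\<in>T. i < n \<and> Suc i \<notin> T \<and> mu (Suc i) = mu i) \<or> (n \<in> T \<and> mu n = 0)"
proof (rule ccontr)
  assume neg: "\<not> ?thesis"
  have anti: "mu (Suc i) \<le> mu i" if "1 \<le> i" "i < n" for i
    using that by (intro Lam_antimono[OF mu]) auto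
  have strict: "mu (Suc i) < mu i" if "i \<in> T" "i < n" "Suc i \<notin> T" for i
    using neg that anti[of i] T by fastforce
  have pos: "0 < mu i" if "i \<in> T" for i
  proof -
    have "i \<le> n" using that T by auto
    then show ?thesis using that
    proof (induction i rule: inc_induct)
      case base
      then show ?case using neg by auto
    next
      case (step i)
      then show ?case
        using strict[of i] anti[of i] T by (cases "Suc i \<in> T") fastforce+
    qed
  qed
  have consecutive: "lower mu T (Suc i) \<le> lower mu T i" if i: "1 \<le> i" "i < n" for i
    using anti[OF i] strict[of i] i
    by (cases "i \<in> T"; cases "Suc i \<in> T") (auto simp: lower_def)
  have "lower mu T j \<le> lower mu T i" if "i \<le> j" "1 \<le> i" "j \<le> n" for i j
    using that
  proof (induction j rule: dec_induct)
    case (step j)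
    then show ?case using consecutive[of j] by simp
  qed simp
  moreover have "lower mu T i = 0" if "i \<notin> {1..n}" for i
    using Lam_outside[OF mu that] by (simp add: lower_def)
  ultimately have "lower mu T \<in> Lam n" unfolding Lam_def by auto
  with pos not show False unfolding lowerable_def by blast
qed

lemma lattice_point_lower:
  assumes "lowerable n mu T" "0 \<notin> T"
  shows "(\<lambda>i. lattice_point n s mu i - (if i \<in> T then 1 else 0)) = lattice_point n s (lower mu T)"
proof
  fix i
  show "lattice_point n s mu i - (if i \<in> T then 1 else 0) = lattice_point n s (lower mu T) i"
  proof (cases "i \<in> T")
    case True
    with assms have "0 < mu i" "0 < i" by (auto simp: lowerable_def intro: gr0I)
    then have "(of_nat (mu i) :: 'a) = of_nat (mu i - 1) + 1"
      by (metis Suc_pred' add.commute of_nat_Suc)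
    with True \<open>0 < i\<close> show ?thesis by (simp add: lattice_point_pos lower_def)
  next
    case False
    then show ?thesis by (simp add: lattice_point_def shifted_def lower_def)
  qed
qed

lemma shifted_gap_prod_lattice_point_eq_0:
  assumes "finite S" "Suc i \<in> S" "0 < i" "i < n" "mu (Suc i) = mu i"
  shows "shifted_gap_prod S i (lattice_point n s mu) = 0"
proof -
  have "lattice_point n s mu i - lattice_point n s mu (Suc i) - lattice_point n s mu 0 = 0"
    using assms by (subst lattice_point_diff) (auto simp: lattice_point_0)
  then show ?thesis unfolding shifted_gap_prod_def using assms(1,2) by (intro prod_zero) auto
qed

text \<open>
  If \<open>\<mu>\<^sub>i = \<mu>\<^sub>i\<^sub>+\<^sub>1\<close>, then the factor \<open>x i - x (i + 1) - x 0\<close> vanishes, and if \<open>i = n\<close> and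
  \<open>\<mu>\<^sub>n = 0\<close>, then the extra factor vanishes.
\<close>

lemma single_num_cutoff:
  assumes mu: "mu \<in> Lam n" and i: "i \<in> odds n" and not: "\<not> lowerable n mu {i}"
  shows "single_num n i (lattice_point n s mu) = 0"
proof -
  have "{i} \<subseteq> {1..n}" using i by (auto simp: odds_def)
  from not_lowerable[OF mu this not]
  consider "i < n" "mu (Suc i) = mu i" | "i = n" "mu n = 0" by auto
  then show ?thesis
  proof cases
    case 1
    then have "shifted_gap_prod (evens n) i (lattice_point n s mu) = 0"
      using i by (intro shifted_gap_prod_lattice_point_eq_0) (auto simp: odds_def evens_def)
    then show ?thesis by (simp add: single_num_def)
  next
    case 2
    then show ?thesis using i by (auto simp: odds_def single_num_def lattice_point_pos)
  qed
qed

lemma pair_num_cutoff: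
  assumes mu: "mu \<in> Lam n" and i: "i \<in> odds n" and j: "j \<in> evens n"
    and not: "\<not> lowerable n mu {i, j}"
  shows "pair_num n i j (lattice_point n s mu) = 0"
proof -
  have "{i, j} \<subseteq> {1..n}" using i j by (auto simp: odds_def evens_def)
  from not_lowerable[OF mu this not]
  consider "i < n" "Suc i \<noteq> j" "mu (Suc i) = mu i" | "j < n" "Suc j \<noteq> i" "mu (Suc j) = mu j"
    | "i = n \<or> j = n" "mu n = 0" by auto
  then show ?thesis
  proof cases
    case 1
    then have "shifted_gap_prod (evens n - {j}) i (lattice_point n s mu) = 0"
      using i j by (intro shifted_gap_prod_lattice_point_eq_0) (auto simp: odds_def evens_def)
    then show ?thesis by (simp add: pair_num_def)
  next
    case 2
    then have "shifted_gap_prod (odds n - {i}) j (lattice_point n s mu) = 0"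
      using i j by (intro shifted_gap_prod_lattice_point_eq_0) (auto simp: odds_def evens_def)
    then show ?thesis by (simp add: pair_num_def)
  next
    case 3
    then show ?thesis using i j
      by (auto simp: odds_def evens_def pair_num_def lattice_point_pos)
  qed
qed

definition single_coeff :: "nat \<Rightarrow> nat \<Rightarrow> (nat \<Rightarrow> 'k::field_char_0) \<Rightarrow> 'k" where
  "single_coeff n i x = single_num n i x / gap_prod (odds n) i x"

definition pair_coeff :: "nat \<Rightarrow> nat \<Rightarrow> nat \<Rightarrow> (nat \<Rightarrow> 'k::field_char_0) \<Rightarrow> 'k" where
  "pair_coeff n i j x = pair_num n i j x / (gap_prod (odds n) i x * gap_prod (evens n) j x)"

lemma weighted_sum_eq:
  "weighted_sum n g x =
     (\<Sum>i\<in>odds n. single_coeff n i x * g {i} x + (\<Sum>j\<in>evens n. pair_coeff n i j x * g {i, j} x))"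
  unfolding weighted_sum_def double_sum_def single_coeff_def pair_coeff_def
  by (intro sum.cong refl) (simp add: add_divide_distrib sum_divide_distrib mult.commute)

text \<open>
  The first of two explicit values from which the sum of all coefficients is
  determined. At \<open>\<mu> = (1, 0, \<dots>, 0)\<close> numerator and denominator are the same product
  of the numbers \<open>(c - 1) s + 1\<close>.
\<close>

lemma single_coeff_first_row:
  fixes t n :: nat
  assumes n: "1 \<le> n" and mu: "mu \<in> Lam n" "0 < t" "mu 1 = 1" "\<And>i. 2 \<le> i \<Longrightarrow> mu i = 0"
  shows "single_coeff n 1 (lattice_point n (of_nat t :: 'k::field_char_0) mu) = 1"
proof -
  define s where "s = (of_nat t :: 'k)"
  define x where "x = lattice_point n s mu"
  define q where "q c = of_nat (c - 1) * s + 1" for c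
  have diff: "x 1 - x c = q c" if "2 \<le> c" "c \<le> n" for c
    unfolding x_def using that mu(3) mu(4)[of c] by (subst lattice_point_diff) (auto simp: q_def)
  have "gap_prod (odds n) 1 x = (\<Prod>c\<in>odds n - {1}. q c)"
    unfolding gap_prod_def by (intro prod.cong refl diff) (auto simp: odds_def)
  also have "\<dots> = (\<Prod>c\<in>odds n. q c)"
    using n by (subst prod.remove[of "odds n" 1]) (auto simp: odds_def q_def)
  also have "\<dots> = (\<Prod>k<(n + 1) div 2. q (2 * k + 1))"
    unfolding odds_eq_image by (subst prod.reindex) (auto simp: inj_on_def)
  finally have gap_prod: "gap_prod (odds n) 1 x = (\<Prod>k<(n + 1) div 2. q (2 * k + 1))" .
  have "shifted_gap_prod (evens n) 1 x = (\<Prod>c\<in>evens n. q (c - 1))"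
    unfolding shifted_gap_prod_def
  proof (intro prod.cong refl)
    fix c assume "c \<in> evens n"
    then have c: "2 \<le> c" "c \<le> n" by (auto simp: evens_def)
    then have "q c = q (c - 1) + s"
      by (simp add: q_def of_nat_diff algebra_simps)
    then show "x 1 - x c - x 0 = q (c - 1)"
      using diff[OF c] by (simp add: x_def lattice_point_0)
  qed
  also have "\<dots> = (\<Prod>k<n div 2. q (2 * k + 1))"
    unfolding evens_eq_image by (subst prod.reindex) (auto simp: inj_on_def)
  finally have shifted_gap_prod: "shifted_gap_prod (evens n) 1 x = (\<Prod>k<n div 2. q (2 * k + 1))" .
  have "single_num n 1 x = gap_prod (odds n) 1 x"
  proof (cases "odd n")
    case True
    then obtain m where m: "n = 2 * m + 1" by (elim oddE)
    have "x 1 = q (2 * m + 1)" using m mu(3) by (simp add: x_def lattice_point_pos q_def)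
    then show ?thesis using True m unfolding single_num_def shifted_gap_prod gap_prod by simp
  next
    case False
    then show ?thesis unfolding single_num_def shifted_gap_prod gap_prod by (auto elim!: evenE)
  qed
  moreover have "gap_prod (odds n) 1 x \<noteq> 0"
    unfolding x_def s_def using n
    by (intro gap_prod_nonzero[OF lattice_point_inj[OF mu(1,2)]] odds_subset) simp
  ultimately show ?thesis by (simp add: single_coeff_def x_def s_def)
qed

text \<open>
  The second explicit value, at \<open>\<mu> = (1, 1, 0, \<dots>, 0)\<close>. The factors with even index
  cancel one by one; those with odd index telescope, and the extra linear factor
  supplies the missing end of the product.
\<close>

lemma pair_coeff_first_rows:
  fixes t n :: nat
  assumes n: "2 \<le> n" and mu: "mu \<in> Lam n" "0 < t" "mu 1 = 1" "mu 2 = 1" "\<And>i. 3 \<le> i \<Longrightarrow> mu i = 0"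
  shows "pair_coeff n 1 2 (lattice_point n (of_nat t :: 'k::field_char_0) mu) = 1"
proof -
  define s where "s = (of_nat t :: 'k)"
  define x where "x = lattice_point n s mu"
  define q where "q c = of_nat (c - 1) * s + 1" for c
  \<comment> \<open>the number of odd indices greater than \<open>1\<close>\<close>
  define m where "m = (n - 1) div 2"
  have m: "(n + 1) div 2 = Suc m" using n unfolding m_def by linarith
  have diff1: "x 1 - x c = q c" if "3 \<le> c" "c \<le> n" for c
    unfolding x_def using that mu by (subst lattice_point_diff) (auto simp: q_def)
  have diff2: "x 2 - x c = q (c - 1)" if "3 \<le> c" "c \<le> n" for c
    unfolding x_def using that mu by (subst lattice_point_diff) (auto simp: q_def numeral_2_eq_2)
  have q_pred: "q c - s = q (c - 1)" if "2 \<le> c" for c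
    using that by (simp add: q_def of_nat_diff algebra_simps)
  have odds: "odds n - {1} = (\<lambda>k. 2 * k + 3) ` {..<m}"
  proof -
    have "{..<(n + 1) div 2} = insert 0 (Suc ` {..<m})"
      unfolding m by (rule lessThan_Suc_eq_insert_0)
    then have "odds n = insert 1 ((\<lambda>k. 2 * k + 3) ` {..<m})"
      unfolding odds_eq_image by (auto simp: image_image)
    then show ?thesis by auto
  qed
  have ge3: "3 \<le> c" if "c \<in> odds n - {1} \<or> c \<in> evens n - {2}" for c
    using that by (auto simp: odds_def evens_def elim!: oddE evenE)
  have num1: "shifted_gap_prod (evens n - {2}) 1 x = gap_prod (evens n) 2 x"
    unfolding shifted_gap_prod_def gap_prod_def
  proof (intro prod.cong refl)
    fix c assume c: "c \<in> evens n - {2}"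
    then have "3 \<le> c" "c \<le> n" using ge3 by (auto simp: evens_def)
    then show "x 1 - x c - x 0 = x 2 - x c"
      using diff1[of c] diff2[of c] q_pred[of c] by (simp add: x_def lattice_point_0)
  qed
  have "shifted_gap_prod (odds n - {1}) 2 x = (\<Prod>c\<in>odds n - {1}. q (c - 2))"
    unfolding shifted_gap_prod_def
  proof (intro prod.cong refl)
    fix c assume c: "c \<in> odds n - {1}"
    then have "3 \<le> c" "c \<le> n" using ge3 by (auto simp: odds_def)
    moreover have "c - 1 - 1 = c - 2" by simp
    ultimately show "x 2 - x c - x 0 = q (c - 2)"
      using diff2[of c] q_pred[of "c - 1"] by (simp add: x_def lattice_point_0)
  qed
  also have "\<dots> = (\<Prod>k<m. q (2 * k + 1))"
    unfolding odds by (subst prod.reindex) (auto simp: inj_on_def)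
  finally have num2: "shifted_gap_prod (odds n - {1}) 2 x = (\<Prod>k<m. q (2 * k + 1))" .
  have "gap_prod (odds n) 1 x = (\<Prod>c\<in>odds n - {1}. q c)"
    unfolding gap_prod_def
  proof (intro prod.cong refl)
    fix c assume c: "c \<in> odds n - {1}"
    then have "3 \<le> c" "c \<le> n" using ge3 by (auto simp: odds_def)
    then show "x 1 - x c = q c" by (rule diff1)
  qed
  also have "\<dots> = (\<Prod>k<m. q (2 * Suc k + 1))"
    unfolding odds by (subst prod.reindex) (auto simp: inj_on_def eval_nat_numeral)
  also have "\<dots> = q (2 * 0 + 1) * (\<Prod>k<m. q (2 * Suc k + 1))" by (simp add: q_def)
  also have "\<dots> = (\<Prod>k<Suc m. q (2 * k + 1))"
    by (rule prod.lessThan_Suc_shift[symmetric])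
  finally have den1: "gap_prod (odds n) 1 x = (\<Prod>k<m. q (2 * k + 1)) * q (2 * m + 1)" by simp
  have edge: "(if odd n then x 1 else x 2) = q (2 * m + 1)"
  proof (cases "odd n")
    case True
    then have "2 * m + 1 = n" using n unfolding m_def by (auto elim!: oddE)
    then show ?thesis using True n mu by (simp add: x_def lattice_point_pos q_def)
  next
    case False
    then have "2 * m + 2 = n" using n unfolding m_def by (auto elim!: evenE)
    then have "n - 2 = 2 * m" by simp
    then show ?thesis using False n mu by (simp add: x_def lattice_point_pos q_def)
  qed
  have "pair_num n 1 2 x = gap_prod (odds n) 1 x * gap_prod (evens n) 2 x"
    unfolding pair_num_def num1 num2 den1 edge by simp
  moreover have "gap_prod (odds n) 1 x \<noteq> 0" "gap_prod (evens n) 2 x \<noteq> 0"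
    unfolding x_def s_def using n
    by (intro gap_prod_nonzero[OF lattice_point_inj[OF mu(1,2)]] odds_subset evens_subset; simp)+
  ultimately show ?thesis by (simp add: pair_coeff_def x_def s_def)
qed

text \<open>
  If \<open>\<bar>\<mu>\<bar> < 2\<close>, then \<open>\<mu>\<close> is \<open>0\<close>, \<open>(1, 0, \<dots>, 0)\<close> or \<open>(1, 1, 0, \<dots>, 0)\<close>, and the cutoff leaves
  at most one nonzero coefficient.
\<close>

lemma weighted_sum_one_small:
  assumes n: "1 \<le> n" and mu: "mu \<in> Lam n" "odd_size n mu < 2" and t: "0 < t"
  shows "weighted_sum n (\<lambda>_ _. 1) (lattice_point n (of_nat t :: 'k::field_char_0) mu)
    = of_nat (odd_size n mu)"
proof -
  let ?x = "lattice_point n (of_nat t :: 'k) mu"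
  have size: "odd_size n mu = sum mu (odds n)" by (simp add: odd_size_def odds_def)
  have one: "1 \<in> odds n" using n by (simp add: odds_def)
  have split: "odd_size n mu = mu 1 + sum mu (odds n - {1})"
    unfolding size using one by (intro sum.remove) auto
  have A0: "single_coeff n i ?x = 0" if "i \<in> odds n" "\<not> lowerable n mu {i}" for i
    using that mu by (simp add: single_coeff_def single_num_cutoff)
  have B0: "pair_coeff n i j ?x = 0" if "i \<in> odds n" "j \<in> evens n" "\<not> lowerable n mu {i, j}" for i j
    using that mu by (simp add: pair_coeff_def pair_num_cutoff)
  have le_first: "mu i \<le> mu 1" for i
    using Lam_antimono[OF mu(1), of 1 i] Lam_outside[OF mu(1), of i] n
    by (cases "i \<in> {1..n}") auto
  show ?thesis
  proof (cases "mu 1 = 0")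
    case True
    then have "mu i = 0" for i using le_first[of i] by simp
    then have "\<not> lowerable n mu {i}" "\<not> lowerable n mu {i, j}" "odd_size n mu = 0" for i j
      unfolding size by (auto simp: lowerable_def)
    then show ?thesis unfolding weighted_sum_eq using A0 B0 by simp
  next
    case False
    with split mu(2) have mu1: "mu 1 = 1" and "sum mu (odds n - {1}) = 0" by linarith+
    then have odd0: "mu i = 0" if "i \<in> odds n - {1}" for i
      using that by (metis finite_Diff finite_odds sum_eq_0_iff)
    have ge3: "mu i = 0" if i: "3 \<le> i" for i
    proof (cases "i \<le> n")
      case True
      then have "mu i \<le> mu 3" using i by (intro Lam_antimono[OF mu(1)]) auto
      moreover have "mu 3 = 0" using True i by (intro odd0) (auto simp: odds_def)
      ultimately show ?thesis by simp
    qed (use Lam_outside[OF mu(1)] in auto)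
    have size1: "odd_size n mu = 1" using split mu1 odd0 by simp
    have rest: "single_coeff n i ?x + (\<Sum>j\<in>evens n. pair_coeff n i j ?x) = 0" if i: "i \<in> odds n - {1}" for i
    proof -
      have "\<not> lowerable n mu {i}" "\<not> lowerable n mu {i, j}" for j
        using odd0[OF i] by (auto simp: lowerable_def)
      then show ?thesis using i A0 B0 by simp
    qed
    have B_ne2: "pair_coeff n 1 j ?x = 0" if "j \<in> evens n" "mu j = 0" for j
      using that one by (intro B0) (auto simp: lowerable_def)
    have "weighted_sum n (\<lambda>_ _. 1) ?x = single_coeff n 1 ?x + (\<Sum>j\<in>evens n. pair_coeff n 1 j ?x)"
      unfolding weighted_sum_eq using one rest by (subst sum.remove[of "odds n" 1]) auto
    also have "\<dots> = 1"
    proof (cases "mu 2 = 0")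
      case True
      then have ge2: "mu i = 0" if "2 \<le> i" for i
        using that ge3[of i] by (cases "i = 2") auto
      have "pair_coeff n 1 j ?x = 0" if j: "j \<in> evens n" for j
        using j by (intro B_ne2 ge2) (auto simp: evens_def elim!: evenE)
      moreover have "single_coeff n 1 ?x = 1" by (rule single_coeff_first_row[OF n mu(1) t mu1 ge2])
      ultimately show ?thesis by simp
    next
      case False
      then have n2: "2 \<le> n" using Lam_outside[OF mu(1), of 2] by force
      have mu2: "mu 2 = 1" using False le_first[of 2] mu1 by simp
      have "lower mu {1} \<notin> Lam n"
        using Lam_antimono[of "lower mu {1}" n 1 2] n2 mu1 mu2 by (auto simp: lower_def)
      then have "single_coeff n 1 ?x = 0" using one by (intro A0) (auto simp: lowerable_def)
      moreover have two: "2 \<in> evens n" using n2 by (simp add: evens_def)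
      then have "(\<Sum>j\<in>evens n. pair_coeff n 1 j ?x) = pair_coeff n 1 2 ?x + (\<Sum>j\<in>evens n - {2}. pair_coeff n 1 j ?x)"
        by (intro sum.remove) auto
      moreover have "(\<Sum>j\<in>evens n - {2}. pair_coeff n 1 j ?x) = 0"
      proof (intro sum.neutral ballI)
        fix j assume j: "j \<in> evens n - {2}"
        then have "3 \<le> j" by (auto simp: evens_def elim!: evenE)
        then show "pair_coeff n 1 j ?x = 0" using B_ne2[of j] ge3[of j] j by simp
      qed
      ultimately show ?thesis using pair_coeff_first_rows[OF n2 mu(1) t mu1 mu2 ge3] by simp
    qed
    finally show ?thesis using size1 by simp
  qed
qed

lemma sum_odds_permute:
  assumes "same_parity n a b"
  shows "(\<Sum>i\<in>odds n. (x \<circ> transpose a b) i) = (\<Sum>i\<in>odds n. x i)"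
  using sum.reindex_bij_betw[OF bij_betw_transpose_odds[OF assms], of x] by simp

text \<open>
  The sum of all coefficients is a semisymmetric polynomial of degree at most \<open>1\<close>.
  It agrees with the sum of \<open>x i - \<rho>\<^sub>i\<close> over the odd indices at all points with \<open>\<bar>\<mu>\<bar> \<le>
  1\<close>, hence everywhere.
\<close>

lemma weighted_sum_one:
  assumes n: "1 \<le> n" and mu: "mu \<in> Lam n" and t: "0 < t"
  shows "weighted_sum n (\<lambda>_ _. 1) (lattice_point n (of_nat t :: 'k::field_char_0) mu)
    = of_nat (odd_size n mu)"
proof -
  define s where "s = (of_nat t :: 'k)"
  define c where "c = (\<lambda>i::nat. if i = 0 then s else 0)"
  have "deg_lt 1 ((\<lambda>_ _. 1) T :: (nat \<Rightarrow> 'k) \<Rightarrow> 'k)" for T :: "nat set"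
    by (intro deg_lt_const) simp
  from weighted_sum_polynomial[of 1 "\<lambda>_ _. 1", OF this, of n]
  obtain G :: "(nat \<Rightarrow> 'k) \<Rightarrow> 'k" where G: "deg_lt 2 G" "semisym n G"
    "\<And>x. inj_on x {1..n} \<Longrightarrow> G x = weighted_sum n (\<lambda>_ _. 1) x"
    by (auto simp: numeral_2_eq_2)
  have G_point: "G (pad n 0 c (shifted n s nu))
      = weighted_sum n (\<lambda>_ _. 1) (lattice_point n s nu)" if "nu \<in> Lam n" for nu
    unfolding c_def pad_shifted[OF that] s_def by (intro G(3) lattice_point_inj that t)
  define f where "f x = G (pad n 0 c x) - (\<Sum>i\<in>odds n. x i - rho n s i)" for x
  have lin: "(\<Sum>i\<in>odds n. shifted n s nu i - rho n s i) = of_nat (odd_size n nu)" for nu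
    by (simp add: shifted_def odd_size_def odds_def)
  have "f x = 0" for x
  proof (rule semisym_zero_if_zero_on_shifted[where f = f and d = 2])
    show "admissible s" unfolding s_def by (rule admissible_of_nat)
    show "deg_lt 2 f" unfolding f_def
      by (rule deg_lt_diff[OF deg_lt_pad[OF G(1)]], rule deg_lt_sum, rule deg_lt_diff[OF deg_lt_var],
          rule deg_lt_const) simp
    show "depends n f" unfolding f_def depends_def
    proof (intro allI impI arg_cong2[of _ _ _ _ "(-)"])
      fix x y :: "nat \<Rightarrow> 'k" assume xy: "\<forall>i\<in>{1..n}. x i = y i"
      show "G (pad n 0 c x) = G (pad n 0 c y)"
        by (rule dependsD[OF depends_pad[of n G]]) (use xy in blast)
      show "(\<Sum>i\<in>odds n. x i - rho n s i) = (\<Sum>i\<in>odds n. y i - rho n s i)"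
        using xy by (intro sum.cong) (auto simp: odds_def)
    qed
    show "semisym n f" unfolding semisym_def
    proof (intro ballI impI allI)
      fix a b and x :: "nat \<Rightarrow> 'k"
      assume ab: "a \<in> {1..n}" "b \<in> {1..n}" "even a = even b"
      have "G (pad n 0 c (x \<circ> transpose a b)) = G (pad n 0 c x)"
        by (rule semisymD[OF semisym_pad[OF G(2) order_refl] ab])
      moreover have "(\<Sum>i\<in>odds n. (x \<circ> transpose a b) i) = (\<Sum>i\<in>odds n. x i)"
        using ab by (intro sum_odds_permute) (simp add: same_parity_def)
      ultimately show "f (x \<circ> transpose a b) = f x" unfolding f_def sum_subtractf by simp
    qed
    fix nu assume "nu \<in> Lam n" "odd_size n nu < 2"
    then show "f (shifted n s nu) = 0"
      unfolding f_def lin using weighted_sum_one_small[OF n _ _ t, where 'k = 'k]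
      by (simp add: G_point flip: s_def)
  qed
  from this[of "shifted n s mu"] show ?thesis
    unfolding f_def lin G_point[OF mu] by (simp add: s_def)
qed

section \<open>Regularity of the coefficients in the parameter\<close>

text \<open>
  Algebraic substitute for a limit: at all but finitely many positive integers \<open>h\<close>
  agrees with a rational function that is defined at \<open>r\<close> and has the value \<open>v\<close> there.
\<close>

definition has_value :: "'k::field_char_0 \<Rightarrow> (nat \<Rightarrow> 'k) \<Rightarrow> 'k \<Rightarrow> bool" where
  "has_value r h v \<longleftrightarrow> (\<exists>p q. poly q r \<noteq> 0 \<and> poly p r = v * poly q r \<and>
     (\<forall>t>0. h t * poly q (of_nat t) = poly p (of_nat t)))"

definition regular :: "'k::field_char_0 \<Rightarrow> (nat \<Rightarrow> 'k) \<Rightarrow> bool" where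
  "regular r h \<longleftrightarrow> (\<exists>v. has_value r h v)"

lemma has_valueI:
  assumes "poly q r \<noteq> 0" "poly p r = v * poly q r"
    and "\<And>t. 0 < t \<Longrightarrow> h t * poly q (of_nat t) = poly p (of_nat t)"
  shows "has_value r h v"
  unfolding has_value_def using assms by blast

text \<open>
  Two univariate polynomials that agree at all positive integers are equal.
\<close>

lemma has_value_unique:
  fixes r :: "'k::field_char_0"
  assumes "has_value r h v" "has_value r h w"
  shows "v = w"
proof -
  obtain p q where pq: "poly q r \<noteq> 0" "poly p r = v * poly q r"
    "\<And>t. 0 < t \<Longrightarrow> h t * poly q (of_nat t) = poly p (of_nat t)"
    using assms(1) unfolding has_value_def by blast
  obtain p' q' where pq': "poly q' r \<noteq> 0" "poly p' r = w * poly q' r"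
    "\<And>t. 0 < t \<Longrightarrow> h t * poly q' (of_nat t) = poly p' (of_nat t)"
    using assms(2) unfolding has_value_def by blast
  have "poly (p * q' - p' * q) (of_nat t) = 0" if "0 < t" for t
    using pq(3)[OF that] pq'(3)[OF that] by (simp flip: pq(3)[OF that] pq'(3)[OF that])
  then have "(of_nat :: nat \<Rightarrow> 'k) ` {0<..} \<subseteq> {x. poly (p * q' - p' * q) x = 0}" by auto
  moreover have "infinite ((of_nat :: nat \<Rightarrow> 'k) ` {0<..})"
    using infinite_Ioi[of "0::nat"] by (simp add: finite_image_iff inj_on_def)
  ultimately have "p * q' - p' * q = 0" using poly_roots_finite infinite_super by blast
  then have "poly (p * q') r = poly (p' * q) r" by simp
  then show ?thesis using pq(1,2) pq'(1,2) by simp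
qed

lemma has_value_cong:
  "has_value r h v \<Longrightarrow> (\<And>t. 0 < t \<Longrightarrow> h t = h' t) \<Longrightarrow> has_value r h' v"
  unfolding has_value_def by metis

lemma has_value_poly: "(\<And>t. h t = poly p (of_nat t)) \<Longrightarrow> has_value r h (poly p r)"
  by (rule has_valueI[of 1 r p]) simp_all

lemma has_value_const: "has_value r (\<lambda>_. c) c"
  using has_value_poly[of "\<lambda>_. c" "[:c:]" r] by simp

lemma has_value_mult:
  assumes "has_value r h v" "has_value r h' w"
  shows "has_value r (\<lambda>t. h t * h' t) (v * w)"
proof -
  obtain p q p' q' where a: "poly q r \<noteq> 0" "poly p r = v * poly q r"
    "\<And>t. 0 < t \<Longrightarrow> h t * poly q (of_nat t) = poly p (of_nat t)"
    "poly q' r \<noteq> 0" "poly p' r = w * poly q' r"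
    "\<And>t. 0 < t \<Longrightarrow> h' t * poly q' (of_nat t) = poly p' (of_nat t)"
    using assms unfolding has_value_def by blast
  show ?thesis
  proof (rule has_valueI[of "q * q'" r "p * p'"])
    fix t :: nat assume t: "0 < t"
    show "h t * h' t * poly (q * q') (of_nat t) = poly (p * p') (of_nat t)"
      by (simp add: mult_ac flip: a(3)[OF t] a(6)[OF t])
  qed (use a in simp_all)
qed

lemma has_value_add:
  assumes "has_value r h v" "has_value r h' w"
  shows "has_value r (\<lambda>t. h t + h' t) (v + w)"
proof -
  obtain p q p' q' where a: "poly q r \<noteq> 0" "poly p r = v * poly q r"
    "\<And>t. 0 < t \<Longrightarrow> h t * poly q (of_nat t) = poly p (of_nat t)"
    "poly q' r \<noteq> 0" "poly p' r = w * poly q' r"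
    "\<And>t. 0 < t \<Longrightarrow> h' t * poly q' (of_nat t) = poly p' (of_nat t)"
    using assms unfolding has_value_def by blast
  show ?thesis
  proof (rule has_valueI[of "q * q'" r "p * q' + p' * q"])
    fix t :: nat assume t: "0 < t"
    show "(h t + h' t) * poly (q * q') (of_nat t) = poly (p * q' + p' * q) (of_nat t)"
      by (simp add: algebra_simps flip: a(3)[OF t] a(6)[OF t])
  qed (use a in \<open>simp_all add: algebra_simps\<close>)
qed

lemma has_value_sum:
  "(\<And>i. i \<in> S \<Longrightarrow> has_value r (h i) (v i)) \<Longrightarrow> has_value r (\<lambda>t. \<Sum>i\<in>S. h i t) (\<Sum>i\<in>S. v i)"
proof (induction S rule: infinite_finite_induct)
  case (insert a S)
  then have "has_value r (\<lambda>t. h a t + (\<Sum>i\<in>S. h i t)) (v a + (\<Sum>i\<in>S. v i))"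
    by (intro has_value_add) auto
  then show ?case using insert.hyps by simp
qed (simp_all add: has_value_const)

lemma regular_mult: "regular r h \<Longrightarrow> regular r h' \<Longrightarrow> regular r (\<lambda>t. h t * h' t)"
  unfolding regular_def using has_value_mult by blast

lemma regular_const: "regular r (\<lambda>_. c)"
  unfolding regular_def using has_value_const by blast

lemma regular_prod:
  "(\<And>i. i \<in> S \<Longrightarrow> regular r (h i)) \<Longrightarrow> regular r (\<lambda>t. \<Prod>i\<in>S. h i t)"
proof (induction S rule: infinite_finite_induct)
  case (insert a S)
  then have "regular r (\<lambda>t. h a t * (\<Prod>i\<in>S. h i t))" by (intro regular_mult) auto
  then show ?case using insert.hyps by simp
qed (simp_all add: regular_const)

lemma regular_cong:
  "regular r h \<Longrightarrow> (\<And>t. 0 < t \<Longrightarrow> h t = h' t) \<Longrightarrow> regular r h'"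
  unfolding regular_def using has_value_cong by metis

lemma regular_linear: "(\<And>t. h t = c * of_nat t + d) \<Longrightarrow> regular r h"
  unfolding regular_def using has_value_poly[of h "[:d, c:]" r] by (auto simp: algebra_simps)

lemma regular_inverse_linear:
  fixes r :: "'k::field_char_0"
  assumes "admissible r" "0 < d" "e \<noteq> 0"
    and h: "\<And>t. h t = e * (of_nat c * of_nat t + of_nat d)"
  shows "regular r (\<lambda>t. 1 / h t)" and "h t \<noteq> 0"
proof -
  have nz: "h t \<noteq> 0" for t
    using admissibleD[OF admissible_of_nat[of t, where 'a = 'k] assms(2), of c] assms(3) by (simp add: h)
  then show "h t \<noteq> 0" .
  have "has_value r (\<lambda>t. 1 / h t) (1 / (e * (of_nat c * r + of_nat d)))"
  proof (rule has_valueI[of "[:e * of_nat d, e * of_nat c:]" r 1])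
    have "e * (of_nat c * r + of_nat d) \<noteq> 0"
      using admissibleD[OF assms(1,2), of c] assms(3) by simp
    moreover have "poly [:e * of_nat d, e * of_nat c:] r = e * (of_nat c * r + of_nat d)"
      by (simp add: algebra_simps)
    ultimately show "poly [:e * of_nat d, e * of_nat c:] r \<noteq> 0"
      "poly 1 r = 1 / (e * (of_nat c * r + of_nat d)) * poly [:e * of_nat d, e * of_nat c:] r"
      by simp_all
    fix t :: nat
    have "poly [:e * of_nat d, e * of_nat c:] (of_nat t) = h t"
      by (simp add: h algebra_simps)
    then show "1 / h t * poly [:e * of_nat d, e * of_nat c:] (of_nat t) = poly 1 (of_nat t)"
      using nz[of t] by simp
  qed
  then show "regular r (\<lambda>t. 1 / h t)" unfolding regular_def by blast
qed

text \<open>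
  Distinct entries of \<open>\<mu>\<close>: the difference of the coordinates is, up to sign, a
  linear function of the parameter with nonnegative slope and positive constant
  term, and so it vanishes at no admissible parameter value. Shifting it by the
  parameter changes only the slope.
\<close>

lemma lattice_point_gap:
  assumes mu: "mu \<in> Lam n" and ab: "a \<in> {1..n}" "b \<in> {1..n}" "mu a \<noteq> mu b"
  obtains e :: "'k::field_char_0" and c c' d :: nat where "0 < d" "e \<noteq> 0"
    "\<And>s. lattice_point n s mu a - lattice_point n s mu b = e * (of_nat c * s + of_nat d)"
    "\<And>s. lattice_point n s mu a - lattice_point n s mu b - s = e * (of_nat c' * s + of_nat d)"
proof (cases "a < b")
  case True
  then have le: "mu b \<le> mu a" using ab by (intro Lam_antimono[OF mu]) auto
  have diff: "lattice_point n s mu a - lattice_point n s mu b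
      = of_nat (b - a) * s + of_nat (mu a - mu b)" for s :: 'k
    using True ab le by (subst lattice_point_diff) (auto simp: of_nat_diff)
  have "b - a = Suc (b - a - 1)" using True by simp
  then have "(of_nat (b - a) :: 'k) = of_nat (b - a - 1) + 1" by (metis Suc_eq_plus1 of_nat_Suc of_nat_1 of_nat_add)
  then show ?thesis
    using le ab diff by (intro that[of "mu a - mu b" 1 "b - a" "b - a - 1"]) (auto simp: algebra_simps)
next
  case False
  with ab have "b < a" by (cases "a = b") auto
  then have le: "mu a \<le> mu b" using ab by (intro Lam_antimono[OF mu]) auto
  have "lattice_point n s mu b - lattice_point n s mu a
      = of_nat (a - b) * s + of_nat (mu b - mu a)" for s :: 'k
    using \<open>b < a\<close> ab le by (subst lattice_point_diff) (auto simp: of_nat_diff)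
  then have diff: "lattice_point n s mu a - lattice_point n s mu b
      = - (of_nat (a - b) * s + of_nat (mu b - mu a))" for s :: 'k
    by (metis minus_diff_eq)
  show ?thesis
    using le ab diff by (intro that[of "mu b - mu a" "-1" "a - b" "Suc (a - b)"]) (auto simp: algebra_simps)
qed

lemma regular_lattice_point:
  "0 < i \<Longrightarrow> regular r (\<lambda>t. lattice_point n (of_nat t) mu i)"
  by (rule regular_linear[of _ "of_nat (n - i)" "of_nat (mu i)"]) (simp add: lattice_point_pos)

lemma regular_factor:
  assumes "0 < a" "0 < b"
  shows "regular r (\<lambda>t. lattice_point n (of_nat t) mu a - lattice_point n (of_nat t) mu b - of_nat t)"
  by (rule regular_linear[of _ "of_nat (n - a) - of_nat (n - b) - 1" "of_nat (mu a) - of_nat (mu b)"])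
    (use assms in \<open>simp add: lattice_point_pos algebra_simps\<close>)

text \<open>
  A pole at \<open>r\<close> is possible only if \<open>\<mu>\<^sub>a = \<mu>\<^sub>b\<close>. Then numerator and denominator are
  both constant multiples of the parameter, which cancels.
\<close>

lemma regular_factor_quotient:
  fixes r :: "'k::field_char_0"
  assumes r: "admissible r" and mu: "mu \<in> Lam n"
    and ab: "a \<in> {1..n}" "b \<in> {1..n}" "a \<noteq> b" and cd: "c \<in> {1..n}" "d \<in> {1..n}"
    and eq: "mu a = mu b \<Longrightarrow> mu c = mu d"
  shows "regular r (\<lambda>t. (lattice_point n (of_nat t) mu c - lattice_point n (of_nat t) mu d - of_nat t)
    / (lattice_point n (of_nat t) mu a - lattice_point n (of_nat t) mu b))"
proof (cases "mu a = mu b")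
  case True
  let ?c = "\<lambda>a. (of_nat (n - a) :: 'k)"
  have "n - a \<noteq> n - b" using ab by auto
  then have "?c a \<noteq> ?c b" by (simp only: of_nat_eq_iff not_False_eq_True)
  have "(lattice_point n (of_nat t) mu c - lattice_point n (of_nat t) mu d - of_nat t)
      / (lattice_point n (of_nat t) mu a - lattice_point n (of_nat t) mu b)
      = (?c c - ?c d - 1) / (?c a - ?c b)" if "0 < t" for t
  proof -
    have "lattice_point n (of_nat t) mu c - lattice_point n (of_nat t) mu d - of_nat t
        = (?c c - ?c d - 1) * of_nat t"
      using eq[OF True] cd by (simp add: lattice_point_pos left_diff_distrib)
    moreover have "lattice_point n (of_nat t) mu a - lattice_point n (of_nat t) mu b
        = (?c a - ?c b) * of_nat t"
      using True ab by (simp add: lattice_point_pos left_diff_distrib)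
    ultimately show ?thesis using that by simp
  qed
  then show ?thesis by (intro regular_cong[OF regular_const]) simp
next
  case False
  obtain e :: 'k and k k' m where gap: "0 < m" "e \<noteq> 0"
    "\<And>s. lattice_point n s mu a - lattice_point n s mu b = e * (of_nat k * s + of_nat m)"
    "\<And>s. lattice_point n s mu a - lattice_point n s mu b - s = e * (of_nat k' * s + of_nat m)"
    by (rule lattice_point_gap[OF mu ab(1,2) False]) (rule that)
  have inv: "regular r (\<lambda>t. 1 / (lattice_point n (of_nat t) mu a - lattice_point n (of_nat t) mu b))"
    by (rule regular_inverse_linear(1)[OF r gap(1,2,3)])
  have "regular r (\<lambda>t. lattice_point n (of_nat t) mu c - lattice_point n (of_nat t) mu d - of_nat t)"
    using cd by (intro regular_factor) auto
  from regular_mult[OF this inv] show ?thesis by simp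
qed

text \<open>
  The factor of the denominator that belongs to \<open>b\<close> is matched with the factor of
  the numerator that belongs to the neighbour of \<open>b\<close> on the side of \<open>a\<close>. Since this
  neighbour lies between \<open>a\<close> and \<open>b\<close>, equality of \<open>\<mu>\<^sub>a\<close> and \<open>\<mu>\<^sub>b\<close> implies equality with the
  entry there, so that each quotient is regular.
\<close>

lemma regular_gap_quotient:
  fixes r :: "'k::field_char_0"
  assumes r: "admissible r" and mu: "mu \<in> Lam n" and a: "a \<in> {1..n}"
  defines "Same \<equiv> {c \<in> {1..n}. even c = even a}" and "Opp \<equiv> {c \<in> {1..n}. even c \<noteq> even a}"
  shows "regular r (\<lambda>t. shifted_gap_prod Opp a (lattice_point n (of_nat t) mu) / gap_prod Same a (lattice_point n (of_nat t) mu))"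
proof -
  let ?L = "\<lambda>t. lattice_point n (of_nat t :: 'k) mu"
  \<comment> \<open>the neighbour of \<open>b\<close> on the side of \<open>a\<close>\<close>
  define \<phi> where "\<phi> b = (if b < a then b + 1 else b - 1)" for b
  have inj: "inj_on \<phi> (Same - {a})"
  proof (rule inj_onI)
    fix b b' assume b: "b \<in> Same - {a}" "b' \<in> Same - {a}" and eq: "\<phi> b = \<phi> b'"
    have ne: "b \<noteq> a" "b' \<noteq> a" "even b = even a" "even b' = even a"
      using b by (auto simp: Same_def)
    then have "Suc b \<noteq> a" "Suc b' \<noteq> a" by auto
    then show "b = b'"
      using eq ne(1,2) unfolding \<phi>_def by (auto split: if_split_asm)
  qed
  have \<phi>: "\<phi> b \<in> Opp" "b < a \<Longrightarrow> b \<le> \<phi> b \<and> \<phi> b \<le> a" "a < b \<Longrightarrow> a \<le> \<phi> b \<and> \<phi> b \<le> b"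
    if "b \<in> Same - {a}" for b
    using that a unfolding \<phi>_def Same_def Opp_def by (auto split: if_splits)
  have fin: "finite Opp" "finite Same" by (simp_all add: Opp_def Same_def)
  have sub: "\<phi> ` (Same - {a}) \<subseteq> Opp" using \<phi>(1) by blast
  have "shifted_gap_prod Opp a (?L t) / gap_prod Same a (?L t)
      = (\<Prod>c\<in>Opp - \<phi> ` (Same - {a}). ?L t a - ?L t c - of_nat t)
        * (\<Prod>b\<in>Same - {a}. (?L t a - ?L t (\<phi> b) - of_nat t) / (?L t a - ?L t b))" for t
    unfolding shifted_gap_prod_def gap_prod_def prod.subset_diff[OF sub fin(1)]
    by (simp add: prod.reindex[OF inj] prod_dividef lattice_point_0)
  moreover have "regular r (\<lambda>t. (\<Prod>c\<in>Opp - \<phi> ` (Same - {a}). ?L t a - ?L t c - of_nat t)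
        * (\<Prod>b\<in>Same - {a}. (?L t a - ?L t (\<phi> b) - of_nat t) / (?L t a - ?L t b)))"
  proof (intro regular_mult regular_prod)
    fix c assume "c \<in> Opp - \<phi> ` (Same - {a})"
    then show "regular r (\<lambda>t. ?L t a - ?L t c - of_nat t)"
      using a by (intro regular_factor) (auto simp: Opp_def)
  next
    fix b assume b: "b \<in> Same - {a}"
    then have bn: "b \<in> {1..n}" "b \<noteq> a" and \<phi>n: "\<phi> b \<in> {1..n}"
      using \<phi>(1)[OF b] by (auto simp: Same_def Opp_def)
    show "regular r (\<lambda>t. (?L t a - ?L t (\<phi> b) - of_nat t) / (?L t a - ?L t b))"
    proof (rule regular_factor_quotient[OF r mu a bn(1) bn(2)[symmetric] a \<phi>n])
      assume "mu a = mu b"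
      then show "mu a = mu (\<phi> b)"
        using \<phi>(2,3)[OF b] Lam_antimono[OF mu bn(1) \<phi>n] Lam_antimono[OF mu \<phi>n a]
          Lam_antimono[OF mu a \<phi>n] Lam_antimono[OF mu \<phi>n bn(1)] bn(2)
        by (cases "b < a") force+
    qed
  qed
  ultimately show ?thesis by simp
qed

lemma regular_gap_quotient_odds:
  assumes "admissible r" "mu \<in> Lam n" "i \<in> odds n"
  shows "regular r (\<lambda>t. shifted_gap_prod (evens n) i (lattice_point n (of_nat t) mu) / gap_prod (odds n) i (lattice_point n (of_nat t) mu))"
proof -
  have "{c \<in> {1..n}. even c = even i} = odds n" "{c \<in> {1..n}. even c \<noteq> even i} = evens n"
    using assms(3) by (auto simp: odds_def evens_def)
  with regular_gap_quotient[OF assms(1,2), of i] assms(3) show ?thesis by (simp add: odds_def)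
qed

lemma regular_gap_quotient_evens:
  assumes "admissible r" "mu \<in> Lam n" "j \<in> evens n"
  shows "regular r (\<lambda>t. shifted_gap_prod (odds n) j (lattice_point n (of_nat t) mu) / gap_prod (evens n) j (lattice_point n (of_nat t) mu))"
proof -
  have "{c \<in> {1..n}. even c = even j} = evens n" "{c \<in> {1..n}. even c \<noteq> even j} = odds n"
    using assms(3) by (auto simp: odds_def evens_def)
  with regular_gap_quotient[OF assms(1,2), of j] assms(3) show ?thesis by (simp add: evens_def)
qed

lemma regular_single_coeff:
  fixes r :: "'k::field_char_0"
  assumes r: "admissible r" and mu: "mu \<in> Lam n" and i: "i \<in> odds n"
  shows "regular r (\<lambda>t. single_coeff n i (lattice_point n (of_nat t) mu))"
proof -
  have "0 < i" using i by (auto simp: odds_def)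
  then have "regular r (\<lambda>t. if odd n then lattice_point n (of_nat t) mu i else 1)"
    by (cases "odd n") (simp_all add: regular_lattice_point regular_const)
  from regular_mult[OF this regular_gap_quotient_odds[OF r mu i]]
  show ?thesis by (simp add: single_coeff_def single_num_def)
qed

text \<open>
  If \<open>\<mu>\<^sub>i = \<mu>\<^sub>j\<close>, the factors of the numerator at \<open>i\<close> are matched with those of the
  denominator at \<open>j\<close> and conversely. If \<open>\<mu>\<^sub>i \<noteq> \<mu>\<^sub>j\<close>, the coefficient is a product of two
  of the regular quotients above, divided by the factors that belong to the pair
  \<open>i, j\<close>; these do not vanish.
\<close>

lemma regular_pair_coeff:
  fixes r :: "'k::field_char_0"
  assumes r: "admissible r" and mu: "mu \<in> Lam n" and i: "i \<in> odds n" and j: "j \<in> evens n"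
  shows "regular r (\<lambda>t. pair_coeff n i j (lattice_point n (of_nat t) mu))"
proof -
  let ?L = "\<lambda>t. lattice_point n (of_nat t :: 'k) mu"
  have ij: "i \<in> {1..n}" "j \<in> {1..n}" "i \<noteq> j" using i j by (auto simp: odds_def evens_def)
  have "regular r (\<lambda>t. if odd n then ?L t i else ?L t j)"
    using ij by (cases "odd n") (simp_all add: regular_lattice_point)
  moreover have "regular r (\<lambda>t. (shifted_gap_prod (evens n - {j}) i (?L t) * shifted_gap_prod (odds n - {i}) j (?L t))
      / (gap_prod (odds n) i (?L t) * gap_prod (evens n) j (?L t)))"
  proof (cases "mu i = mu j")
    case True
    have "regular r (\<lambda>t. \<Prod>c\<in>evens n - {j}. (?L t i - ?L t c - of_nat t) / (?L t j - ?L t c))"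
      using True ij by (intro regular_prod regular_factor_quotient[OF r mu]) (auto simp: evens_def)
    moreover have "regular r (\<lambda>t. \<Prod>c\<in>odds n - {i}. (?L t j - ?L t c - of_nat t) / (?L t i - ?L t c))"
      using True ij by (intro regular_prod regular_factor_quotient[OF r mu]) (auto simp: odds_def)
    ultimately have "regular r (\<lambda>t. (\<Prod>c\<in>evens n - {j}. (?L t i - ?L t c - of_nat t) / (?L t j - ?L t c))
        * (\<Prod>c\<in>odds n - {i}. (?L t j - ?L t c - of_nat t) / (?L t i - ?L t c)))"
      by (rule regular_mult)
    then show ?thesis
      by (simp add: prod_dividef shifted_gap_prod_def gap_prod_def lattice_point_0 mult.commute)
  next
    case False
    obtain e :: 'k and k k' m where 1: "0 < m" "e \<noteq> 0"
      "\<And>s. lattice_point n s mu i - lattice_point n s mu j = e * (of_nat k * s + of_nat m)"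
      "\<And>s. lattice_point n s mu i - lattice_point n s mu j - s = e * (of_nat k' * s + of_nat m)"
      by (rule lattice_point_gap[OF mu ij(1,2) False]) (rule that)
    obtain e' :: 'k and l l' m' where 2: "0 < m'" "e' \<noteq> 0"
      "\<And>s. lattice_point n s mu j - lattice_point n s mu i = e' * (of_nat l * s + of_nat m')"
      "\<And>s. lattice_point n s mu j - lattice_point n s mu i - s = e' * (of_nat l' * s + of_nat m')"
      by (rule lattice_point_gap[OF mu ij(2,1) False[symmetric]]) (rule that)
    define X where "X t = ?L t i - ?L t j - of_nat t" for t
    define Y where "Y t = ?L t j - ?L t i - of_nat t" for t
    have X: "regular r (\<lambda>t. 1 / X t)" "X t \<noteq> 0" for t
      using regular_inverse_linear[OF r 1(1,2), of X k'] 1(4) by (simp_all add: X_def)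
    have Y: "regular r (\<lambda>t. 1 / Y t)" "Y t \<noteq> 0" for t
      using regular_inverse_linear[OF r 2(1,2), of Y l'] 2(4) by (simp_all add: Y_def)
    have cancel: "N * M / (D * E) = ((x * N / D) * (y * M / E)) * ((1 / x) * (1 / y))"
      if "x \<noteq> 0" "y \<noteq> 0" for x y N M D E :: 'k
      using that by simp
    have "shifted_gap_prod (evens n) i (?L t) = X t * shifted_gap_prod (evens n - {j}) i (?L t)" for t
      unfolding shifted_gap_prod_def X_def using j by (subst prod.remove[of _ j]) (simp_all add: lattice_point_0)
    moreover have "shifted_gap_prod (odds n) j (?L t) = Y t * shifted_gap_prod (odds n - {i}) j (?L t)" for t
      unfolding shifted_gap_prod_def Y_def using i by (subst prod.remove[of _ i]) (simp_all add: lattice_point_0)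
    ultimately have eq: "(shifted_gap_prod (evens n - {j}) i (?L t) * shifted_gap_prod (odds n - {i}) j (?L t))
        / (gap_prod (odds n) i (?L t) * gap_prod (evens n) j (?L t))
      = ((shifted_gap_prod (evens n) i (?L t) / gap_prod (odds n) i (?L t)) * (shifted_gap_prod (odds n) j (?L t) / gap_prod (evens n) j (?L t)))
        * ((1 / X t) * (1 / Y t))" for t
      using cancel[OF X(2)[of t] Y(2)[of t]] by (simp only:)
    show ?thesis unfolding eq
      by (intro regular_mult X(1) Y(1) regular_gap_quotient_odds[OF r mu i] regular_gap_quotient_evens[OF r mu j])
  qed
  ultimately have "regular r (\<lambda>t. (if odd n then ?L t i else ?L t j) *
      ((shifted_gap_prod (evens n - {j}) i (?L t) * shifted_gap_prod (odds n - {i}) j (?L t))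
      / (gap_prod (odds n) i (?L t) * gap_prod (evens n) j (?L t))))"
    by (rule regular_mult)
  then show ?thesis by (simp add: pair_coeff_def pair_num_def)
qed

section \<open>The eigenvalue equation and extra vanishing\<close>

definition steps :: "nat \<Rightarrow> nat set set" where
  "steps n = {{i} | i. i \<in> odds n} \<union> {{i, j} | i j. i \<in> odds n \<and> j \<in> evens n}"

lemma lattice_point_curve: "\<exists>p. \<forall>s. lattice_point n s mu i = poly p s"
proof (cases "i = 0")
  case True
  then show ?thesis by (intro exI[of _ "[:0, 1:]"]) (simp add: lattice_point_0)
next
  case False
  then show ?thesis
    by (intro exI[of _ "[:of_nat (mu i), of_nat (n - i):]"]) (simp add: lattice_point_pos algebra_simps)
qed

lemma has_value_on_lattice_points:
  assumes "deg_lt d f"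
  shows "has_value r (\<lambda>t. f (lattice_point n (of_nat t) mu)) (f (lattice_point n r mu))"
proof -
  obtain p where p: "\<And>s. f (\<lambda>i. lattice_point n s mu i) = poly p s"
    using deg_lt_on_curve[OF assms, of "\<lambda>i s. lattice_point n s mu i"] lattice_point_curve by blast
  then have "has_value r (\<lambda>t. f (lattice_point n (of_nat t) mu)) (poly p r)"
    by (intro has_value_poly) simp
  then show ?thesis using p[of r] by simp
qed

text \<open>
  The operator \<open>E\<close> at the parameter \<open>r\<close>, described only by what the main argument
  needs. The last property is proved by passing from positive integer parameters
  to \<open>r\<close>. On the way the values of \<open>f\<close> at the lowered points are multiplied by
  coefficients that are regular at \<open>r\<close>, so their contribution has the value zero
  there.
\<close>

theorem difference_operator:
  fixes r :: "'k::field_char_0"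
  assumes n: "1 \<le> n" and r: "admissible r"
    and f: "deg_lt (Suc d) f" "semisym n f" "depends n f"
  obtains E where "deg_lt (Suc d) E" "semisym n E" "depends n E"
    "\<And>mu. \<lbrakk>mu \<in> Lam n; \<And>T. \<lbrakk>T \<in> steps n; lowerable n mu T\<rbrakk> \<Longrightarrow> f (shifted n r (lower mu T)) = 0\<rbrakk>
      \<Longrightarrow> E (shifted n r mu) = of_nat (odd_size n mu) * f (shifted n r mu)"
proof -
  define v where "v T = (\<lambda>i. if i \<in> T then 1 else 0 :: 'k)" for T :: "nat set"
  define g where "g T x = f x - f (\<lambda>i. x i - v T i)" for T x
  have f_lattice: "f (lattice_point n s mu) = f (shifted n s mu)" for s mu
    by (rule dependsD[OF f(3)]) (simp add: lattice_point_def)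
  have "\<exists>G. deg_lt (Suc d) G \<and> semisym n G \<and> (\<forall>x. inj_on x {1..n} \<longrightarrow> G x = weighted_sum n g x)"
  proof (rule weighted_sum_polynomial)
    show "deg_lt d (g T)" for T
      using deg_lt_difference[OF f(1), of "v T"] by (simp add: g_def[abs_def])
    fix a b T and x :: "nat \<Rightarrow> 'k" assume p: "same_parity n a b"
    then have sym: "f (y \<circ> transpose a b) = f y" for y
      by (intro semisymD[OF f(2)]) (auto simp: same_parity_def)
    have "(\<lambda>i. (x \<circ> transpose a b) i - v T i) = (\<lambda>i. x i - v (transpose a b ` T) i) \<circ> transpose a b"
      using inj_image_mem_iff[of "transpose a b" _ T] by (simp add: v_def fun_eq_iff)
    then show "g T (x \<circ> transpose a b) = g (transpose a b ` T) x"
      unfolding g_def by (simp only: sym)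
  qed
  then obtain G where G: "deg_lt (Suc d) G" "semisym n G"
    "\<And>x. inj_on x {1..n} \<Longrightarrow> G x = weighted_sum n g x" by blast
  define c where "c = (\<lambda>i::nat. if i = 0 then r else 0)"
  show thesis
  proof (rule that[of "\<lambda>x. G (pad n 0 c x)"])
    show "deg_lt (Suc d) (\<lambda>x. G (pad n 0 c x))" by (rule deg_lt_pad[OF G(1)])
    show "semisym n (\<lambda>x. G (pad n 0 c x))" by (rule semisym_pad[OF G(2) order_refl])
    show "depends n (\<lambda>x. G (pad n 0 c x))" by (rule depends_pad)
    fix mu assume mu: "mu \<in> Lam n"
      and vanish: "\<And>T. \<lbrakk>T \<in> steps n; lowerable n mu T\<rbrakk> \<Longrightarrow> f (shifted n r (lower mu T)) = 0"
    let ?L = "\<lambda>t. lattice_point n (of_nat t :: 'k) mu"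
    \<comment> \<open>At points outside \<open>Lam n\<close> the coefficient is zero, so that the value of \<open>f\<close> may be replaced by \<open>0\<close>.\<close>
    define h where "h T t = (if lowerable n mu T then f (lattice_point n (of_nat t) (lower mu T)) else 0)"
      for T and t :: nat
    have h0: "has_value r (h T) 0" if T: "T \<in> steps n" for T
    proof (cases "lowerable n mu T")
      case True
      with has_value_on_lattice_points[OF f(1), of r n "lower mu T"] vanish[OF T] f_lattice[of r]
      show ?thesis by (simp add: h_def[abs_def])
    next
      case False
      then show ?thesis using has_value_const[of r 0] by (simp add: h_def[abs_def])
    qed
    have regular_times_h: "has_value r (\<lambda>t. q t * h T t) 0" if "regular r q" "T \<in> steps n" for q T
      using that h0 has_value_mult[of r q _ "h T" 0] unfolding regular_def by auto
    have moved: "f (\<lambda>i. ?L t i - v T i) = h T t" if "lowerable n mu T" "0 \<notin> T" for T t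
      using that lattice_point_lower[OF that, of "of_nat t :: 'k"] by (simp add: h_def v_def)
    have G_eq: "of_nat (odd_size n mu) * f (?L t) + (- 1) * (\<Sum>i\<in>odds n. single_coeff n i (?L t) * h {i} t
          + (\<Sum>j\<in>evens n. pair_coeff n i j (?L t) * h {i, j} t)) = G (?L t)" if t: "0 < t" for t
    proof -
      have A: "single_coeff n i (?L t) * g {i} (?L t)
          = f (?L t) * (single_coeff n i (?L t) * 1) - single_coeff n i (?L t) * h {i} t" if i: "i \<in> odds n" for i
      proof (cases "lowerable n mu {i}")
        case True
        have "0 \<notin> {i}" using i by (auto simp: odds_def)
        from moved[OF True this, of t] show ?thesis by (simp add: g_def algebra_simps)
      next
        case False
        then show ?thesis using single_num_cutoff[OF mu i False, of "of_nat t :: 'k"] by (simp add: single_coeff_def)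
      qed
      have B: "pair_coeff n i j (?L t) * g {i, j} (?L t)
          = f (?L t) * (pair_coeff n i j (?L t) * 1) - pair_coeff n i j (?L t) * h {i, j} t"
        if i: "i \<in> odds n" and j: "j \<in> evens n" for i j
      proof (cases "lowerable n mu {i, j}")
        case True
        have "0 \<notin> {i, j}" using i j by (auto simp: odds_def evens_def)
        from moved[OF True this, of t] show ?thesis by (simp add: g_def algebra_simps)
      next
        case False
        then show ?thesis using pair_num_cutoff[OF mu i j False, of "of_nat t :: 'k"] by (simp add: pair_coeff_def)
      qed
      have "G (?L t) = weighted_sum n g (?L t)" by (intro G(3) lattice_point_inj mu t)
      also have "\<dots> = (\<Sum>i\<in>odds n. (f (?L t) * (single_coeff n i (?L t) * 1) - single_coeff n i (?L t) * h {i} t)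
          + (\<Sum>j\<in>evens n. f (?L t) * (pair_coeff n i j (?L t) * 1) - pair_coeff n i j (?L t) * h {i, j} t))"
        unfolding weighted_sum_eq by (intro sum.cong refl arg_cong2[of _ _ _ _ "(+)"] A B)
      also have "\<dots> = f (?L t) * weighted_sum n (\<lambda>_ _. 1) (?L t)
          - (\<Sum>i\<in>odds n. single_coeff n i (?L t) * h {i} t + (\<Sum>j\<in>evens n. pair_coeff n i j (?L t) * h {i, j} t))"
        unfolding weighted_sum_eq sum_distrib_left sum_subtractf[symmetric]
        by (intro sum.cong refl) (simp add: sum_subtractf sum_distrib_left algebra_simps)
      finally show ?thesis using weighted_sum_one[OF n mu t, where 'k = 'k] by simp
    qed
    have "has_value r (\<lambda>t. of_nat (odd_size n mu) * f (?L t) + (- 1) * (\<Sum>i\<in>odds n. single_coeff n i (?L t) * h {i} t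
        + (\<Sum>j\<in>evens n. pair_coeff n i j (?L t) * h {i, j} t)))
      (of_nat (odd_size n mu) * f (lattice_point n r mu) + (- 1) * (\<Sum>i\<in>odds n. 0 + (\<Sum>j\<in>evens n. 0)))"
      by (intro has_value_add has_value_mult has_value_const has_value_sum
          has_value_on_lattice_points[OF f(1)] regular_times_h regular_single_coeff[OF r mu] regular_pair_coeff[OF r mu])
        (auto simp: steps_def)
    then have "has_value r (\<lambda>t. G (?L t)) (of_nat (odd_size n mu) * f (lattice_point n r mu))"
      using has_value_cong[OF _ G_eq] by simp
    from has_value_unique[OF has_value_on_lattice_points[OF G(1)] this]
    show "G (pad n 0 c (shifted n r mu)) = of_nat (odd_size n mu) * f (shifted n r mu)"
      unfolding c_def pad_shifted[OF mu] f_lattice .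
  qed
qed

lemma steps_subset: "T \<in> steps n \<Longrightarrow> T \<subseteq> {1..n}"
  by (auto simp: steps_def odds_def evens_def)

lemma odd_size_lower:
  assumes "T \<in> steps n" "lowerable n mu T"
  shows "odd_size n mu = Suc (odd_size n (lower mu T))"
proof -
  obtain i where i: "i \<in> odds n" "i \<in> T" "\<And>k. k \<in> odds n - {i} \<Longrightarrow> k \<notin> T"
    using assms(1) by (auto simp: steps_def odds_def evens_def)
  have "0 < mu i" using assms(2) i(2) by (simp add: lowerable_def)
  moreover have "sum (lower mu T) (odds n - {i}) = sum mu (odds n - {i})"
    using i(3) by (intro sum.cong) (auto simp: lower_def)
  moreover have "odd_size n k = k i + sum k (odds n - {i})" for k
    unfolding odd_size_def odds_def[symmetric] using i(1) by (intro sum.remove) auto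
  ultimately show ?thesis using i(2) by (simp add: lower_def)
qed

text \<open>
  A step \<open>e\<^sub>i\<close> with \<open>i\<close> odd lowers \<open>[\<mu>]\<^sub>1\<close> by \<open>1\<close>, and for \<open>e\<^sub>i + e\<^sub>j\<close> the two contributions
  cancel.
\<close>

lemma bracket_lower:
  assumes T: "T \<in> steps n" and low: "lowerable n mu T"
  shows "bracket n (lower mu T) 1 \<le> bracket n mu 1"
proof -
  have "bracket n mu 1 - bracket n (lower mu T) 1
      = (\<Sum>i = 1..n. (-1) ^ (i - 1) * (int (mu i) - int (lower mu T i)))"
    unfolding bracket_def by (simp add: sum_subtractf right_diff_distrib)
  also have "\<dots> = (\<Sum>i = 1..n. if i \<in> T then (-1) ^ (i - 1) else 0)"
    using low by (intro sum.cong) (auto simp: lowerable_def lower_def of_nat_diff Suc_le_eq)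
  also have "\<dots> = (\<Sum>i\<in>T. (-1) ^ (i - 1))"
    using steps_subset[OF T] by (simp add: sum.inter_restrict[symmetric] Int_absorb1)
  also have "\<dots> \<ge> 0"
    using T unfolding steps_def
  proof (elim UnE CollectE exE conjE)
    fix i assume "T = {i}" "i \<in> odds n"
    then show ?thesis by (auto simp: odds_def)
  next
    fix i j assume "T = {i, j}" "i \<in> odds n" "j \<in> evens n"
    then show ?thesis by (cases "i = j") (auto simp: odds_def evens_def)
  qed
  finally show ?thesis by simp
qed

lemma sqle_lower:
  assumes "T \<in> steps n" "lowerable n mu T" "sqle n lam (lower mu T)"
  shows "sqle n lam mu"
proof -
  have "lower mu T i \<le> mu i" for i by (simp add: lower_def)
  then show ?thesis
    using assms(3) bracket_lower[OF assms(1,2)] unfolding sqle_def by (meson order_trans)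
qed

theorem theorem4p9:
  fixes n :: nat and r :: "'k::field_char_0"
    and lam mu :: "nat \<Rightarrow> nat" and R :: "'k mpoly"
  assumes "n \<ge> 1"
    and "\<not> (\<exists>q::rat. q < 0 \<and> r = of_rat q)"
    and "lam \<in> Lam n" and "mu \<in> Lam n"
    and "is_R n r lam R"
    and "\<not> sqle n lam mu"
  shows "eval_poly R (shifted n r mu) = 0"
proof -
  define f where "f = eval_poly R"
  define d where "d = odd_size n lam"
  have r: "admissible r" using assms(2) by (rule admissibleI)
  have R: "R \<in> invariant_polys n" "total_degree R = d"
    and vanish: "\<And>nu. \<lbrakk>nu \<in> Lam n; odd_size n nu \<le> d; nu \<noteq> lam\<rbrakk> \<Longrightarrow> f (shifted n r nu) = 0"
    using assms(5) by (auto simp: is_R_def d_def f_def)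
  have f: "deg_lt (Suc d) f" "semisym n f" "depends n f"
    using deg_lt_eval_poly[of R] semisym_eval_poly[OF R(1)] depends_eval_poly[of R n] R
    by (simp_all add: f_def invariant_polys_def)
  obtain E where E: "deg_lt (Suc d) E" "semisym n E" "depends n E"
    "\<And>mu. \<lbrakk>mu \<in> Lam n; \<And>T. \<lbrakk>T \<in> steps n; lowerable n mu T\<rbrakk> \<Longrightarrow> f (shifted n r (lower mu T)) = 0\<rbrakk>
      \<Longrightarrow> E (shifted n r mu) = of_nat (odd_size n mu) * f (shifted n r mu)"
    using difference_operator[OF assms(1) r f] by blast
  have eigen: "E x - of_nat d * f x = 0" for x
  proof (rule semisym_zero_if_zero_on_shifted[OF r, where f = "\<lambda>x. E x - of_nat d * f x"])
    show "deg_lt (Suc d) (\<lambda>x. E x - of_nat d * f x)"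
      by (intro deg_lt_diff deg_lt_scale E(1) f(1))
    show "semisym n (\<lambda>x. E x - of_nat d * f x)"
      using E(2) f(2) by (simp add: semisym_def)
    show "depends n (\<lambda>x. E x - of_nat d * f x)"
      using E(3) f(3) unfolding depends_def by metis
    fix nu assume nu: "nu \<in> Lam n" "odd_size n nu < Suc d"
    have "E (shifted n r nu) = of_nat (odd_size n nu) * f (shifted n r nu)"
    proof (rule E(4)[OF nu(1)])
      fix T assume T: "T \<in> steps n" "lowerable n nu T"
      have "odd_size n (lower nu T) < d" using odd_size_lower[OF T] nu(2) by simp
      then show "f (shifted n r (lower nu T)) = 0"
        using T(2) by (intro vanish) (auto simp: lowerable_def d_def)
    qed
    then show "E (shifted n r nu) - of_nat d * f (shifted n r nu) = 0"
      using vanish[OF nu(1)] nu(2) by (cases "nu = lam") (auto simp: d_def)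
  qed
  have "\<lbrakk>nu \<in> Lam n; \<not> sqle n lam nu\<rbrakk> \<Longrightarrow> f (shifted n r nu) = 0" for nu
  proof (induction "odd_size n nu" arbitrary: nu rule: less_induct)
    case less
    show ?case
    proof (cases "odd_size n nu \<le> d")
      case True
      moreover have "nu \<noteq> lam" using less.prems by (auto simp: sqle_def)
      ultimately show ?thesis using less.prems by (intro vanish)
    next
      case False
      have "E (shifted n r nu) = of_nat (odd_size n nu) * f (shifted n r nu)"
      proof (rule E(4)[OF less.prems(1)])
        fix T assume T: "T \<in> steps n" "lowerable n nu T"
        show "f (shifted n r (lower nu T)) = 0"
        proof (rule less.hyps)
          show "odd_size n (lower nu T) < odd_size n nu" using odd_size_lower[OF T] by simp
          show "lower nu T \<in> Lam n" using T(2) by (simp add: lowerable_def)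
          show "\<not> sqle n lam (lower nu T)" using sqle_lower[OF T] less.prems(2) by blast
        qed
      qed
      with eigen[of "shifted n r nu"]
      have "(of_nat (odd_size n nu) - of_nat d) * f (shifted n r nu) = 0"
        by (simp add: left_diff_distrib)
      moreover have "(of_nat (odd_size n nu) :: 'k) - of_nat d \<noteq> 0" using False by simp
      ultimately show ?thesis by simp
    qed
  qed
  with assms(4,6) show ?thesis by (simp add: f_def)
qed

end
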